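(* Let $n\ge 1$, let $(M^{2n+1},\eta,H)$ be a smooth autonomous contact Hamiltonian system with Reeb vector field $R$, let $X=X_H$, $a=R(H)$ and $\mu=\eta\wedge(d\eta)^n$. Let $\beta$ be a smooth one-form on $M$ satisfying $\mathcal L_X\beta=-a\beta$. Then $J=-\beta(X)$ is dissipated, i.e. $X(J)=-aJ$. Moreover, define functions $C_1,\ldots,C_{n+1}$ on $M$ by $$(\eta+t\beta)\wedge(d\eta+t\,d\beta)^n=\Bigl(1+\sum_{j=1}^{n+1}C_jt^j\Bigr)\mu,$$ where $t$ is an auxiliary (real) parameter. Then $$X(C_j)=0,\qquad X(HC_j)=-a\,HC_j,\qquad j=1,\ldots,n+1.$$ (Neither $\beta$ nor every one-form $\eta+t\beta$ is required to be contact.)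
   Context: A contact Hamiltonian system $(M^{2n+1},\eta,H)$ is a smooth manifold $M$ of dimension $2n+1$ with a contact form $\eta$ (i.e. $\eta\wedge(d\eta)^n$ is nowhere zero) and a smooth function $H$. The Reeb vector field $R$ is defined by $\eta(R)=1$, $\iota_Rd\eta=0$. The contact Hamiltonian vector field $X_H$ is defined by the convention $\eta(X_H)=-H$, $\iota_{X_H}d\eta=dH-R(H)\eta$. A function $I$ is conserved if $X_H(I)=0$; a function $f$ is dissipated if $X_H(f)=-af$, where $a=R(H)$. *)

theory Defs
  imports "HOL-Analysis.Analysis" "HOL-Combinatorics.Permutations"
begin

section \<open>Smooth maps on open subsets of Euclidean space\<close>

text \<open>Used only for open \<^term>\<open>S\<close>. The domain is finite-dimensional, so smoothness can be
  expressed through iterated directional derivatives.\<close>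

primrec Ck_on :: "nat \<Rightarrow> ('a::euclidean_space \<Rightarrow> 'b::real_normed_vector) \<Rightarrow> 'a set \<Rightarrow> bool" where
  "Ck_on 0 f S \<longleftrightarrow> continuous_on S f"
| "Ck_on (Suc k) f S \<longleftrightarrow>
     f differentiable_on S \<and> (\<forall>v. Ck_on k (\<lambda>x. frechet_derivative f (at x) v) S)"

definition smooth_on :: "('a::euclidean_space \<Rightarrow> 'b::real_normed_vector) \<Rightarrow> 'a set \<Rightarrow> bool" where
  "smooth_on f S \<longleftrightarrow> (\<forall>k. Ck_on k f S)"

section \<open>Smooth manifolds\<close>

type_synonym ('m, 'e) chart = "'m set \<times> ('m \<Rightarrow> 'e)"

abbreviation chart_dom :: "('m, 'e) chart \<Rightarrow> 'm set" where
  "chart_dom c \<equiv> fst c"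

abbreviation coords :: "('m, 'e) chart \<Rightarrow> 'm \<Rightarrow> 'e" where
  "coords c \<equiv> snd c"

definition chart_target :: "('m, 'e) chart \<Rightarrow> 'e set" where
  "chart_target c = coords c ` chart_dom c"

definition chart_inv :: "('m, 'e) chart \<Rightarrow> 'e \<Rightarrow> 'm" where
  "chart_inv c = inv_into (chart_dom c) (coords c)"

definition is_chart :: "'m topology \<Rightarrow> ('m, 'e::euclidean_space) chart \<Rightarrow> bool" where
  "is_chart M c \<longleftrightarrow> openin M (chart_dom c) \<and> open (chart_target c) \<and>
     homeomorphic_map (subtopology M (chart_dom c)) (top_of_set (chart_target c)) (coords c)"

definition overlap :: "('m, 'e) chart \<Rightarrow> ('m, 'e) chart \<Rightarrow> 'e set" where
  "overlap c d = coords c ` (chart_dom c \<inter> chart_dom d)"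

definition transition :: "('m, 'e) chart \<Rightarrow> ('m, 'e) chart \<Rightarrow> 'e \<Rightarrow> 'e" where
  "transition c d = coords d \<circ> chart_inv c"

text \<open>A manifold is given by its underlying space and an atlas, which need not be maximal. Its
  dimension is \<open>DIM('e)\<close>.\<close>

definition smooth_manifold :: "'m topology \<Rightarrow> ('m, 'e::euclidean_space) chart set \<Rightarrow> bool" where
  "smooth_manifold M A \<longleftrightarrow>
     Hausdorff_space M \<and> second_countable M \<and>
     (\<forall>c\<in>A. is_chart M c) \<and> (\<Union>c\<in>A. chart_dom c) = topspace M \<and>
     (\<forall>c\<in>A. \<forall>d\<in>A. smooth_on (transition c d) (overlap c d))"

definition smooth_fun :: "('m, 'e::euclidean_space) chart set \<Rightarrow> ('m \<Rightarrow> real) \<Rightarrow> bool" where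
  "smooth_fun A f \<longleftrightarrow> (\<forall>c\<in>A. smooth_on (f \<circ> chart_inv c) (chart_target c))"

section \<open>Vector fields and differential forms\<close>

text \<open>A vector field or form on the manifold is a family of local representatives, one for each
  chart of the atlas, related by pushforward or pullback along the transition maps. The
  representative of a \<open>k\<close>-form at a coordinate point is a function of a sequence of
  vectors of which only the entries \<open>0, \<dots>, k - 1\<close> matter. Values at coordinates
  outside the target of a chart are irrelevant.\<close>

type_synonym ('m, 'e) vfield = "('m, 'e) chart \<Rightarrow> 'e \<Rightarrow> 'e"

type_synonym ('m, 'e) form = "('m, 'e) chart \<Rightarrow> 'e \<Rightarrow> (nat \<Rightarrow> 'e) \<Rightarrow> real"

definition vector_field ::
    "('m, 'e::euclidean_space) chart set \<Rightarrow> ('m, 'e) vfield \<Rightarrow> bool" where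
  "vector_field A X \<longleftrightarrow>
     (\<forall>c\<in>A. smooth_on (X c) (chart_target c)) \<and>
     (\<forall>c\<in>A. \<forall>d\<in>A. \<forall>x\<in>overlap c d.
        X d (transition c d x) = frechet_derivative (transition c d) (at x) (X c x))"

definition alternating_form :: "nat \<Rightarrow> ((nat \<Rightarrow> 'e::real_vector) \<Rightarrow> real) \<Rightarrow> bool" where
  "alternating_form k \<alpha> \<longleftrightarrow>
     (\<forall>v w. (\<forall>i<k. v i = w i) \<longrightarrow> \<alpha> v = \<alpha> w) \<and>
     (\<forall>v. \<forall>i<k. linear (\<lambda>u. \<alpha> (v(i := u)))) \<and>
     (\<forall>v. \<forall>i<k. \<forall>j<k. i \<noteq> j \<and> v i = v j \<longrightarrow> \<alpha> v = 0)"

definition diff_form ::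
    "('m, 'e::euclidean_space) chart set \<Rightarrow> nat \<Rightarrow> ('m, 'e) form \<Rightarrow> bool" where
  "diff_form A k \<omega> \<longleftrightarrow>
     (\<forall>c\<in>A. (\<forall>x\<in>chart_target c. alternating_form k (\<omega> c x)) \<and>
            (\<forall>v. smooth_on (\<lambda>x. \<omega> c x v) (chart_target c))) \<and>
     (\<forall>c\<in>A. \<forall>d\<in>A. \<forall>x\<in>overlap c d. \<forall>v.
        \<omega> c x v = \<omega> d (transition c d x) (\<lambda>i. frechet_derivative (transition c d) (at x) (v i)))"

definition form_eq ::
    "('m, 'e) chart set \<Rightarrow> ('m, 'e) form \<Rightarrow> ('m, 'e) form \<Rightarrow> bool" where
  "form_eq A \<omega> \<theta> \<longleftrightarrow> (\<forall>c\<in>A. \<forall>x\<in>chart_target c. \<omega> c x = \<theta> c x)"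

text \<open>Functions on the manifold as 0-forms, and conversely the value at a point of a 0-form,
  which is the same in every chart around that point.\<close>

definition of_fun :: "('m \<Rightarrow> real) \<Rightarrow> ('m, 'e) form" where
  "of_fun f = (\<lambda>c x v. f (chart_inv c x))"

definition fun_of :: "('m, 'e::zero) chart set \<Rightarrow> ('m, 'e) form \<Rightarrow> 'm \<Rightarrow> real" where
  "fun_of A \<omega> p = (let c = (SOME c. c \<in> A \<and> p \<in> chart_dom c) in \<omega> c (coords c p) (\<lambda>_. 0))"

definition form_add :: "('m, 'e) form \<Rightarrow> ('m, 'e) form \<Rightarrow> ('m, 'e) form" (infixl "+\<^sub>F" 65) where
  "\<omega> +\<^sub>F \<theta> = (\<lambda>c x v. \<omega> c x v + \<theta> c x v)"

definition form_scale :: "('m \<Rightarrow> real) \<Rightarrow> ('m, 'e) form \<Rightarrow> ('m, 'e) form" (infixr "*\<^sub>F" 75) where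
  "f *\<^sub>F \<omega> = (\<lambda>c x v. f (chart_inv c x) * \<omega> c x v)"

text \<open>Wedge product of a \<open>k\<close>-form and an \<open>l\<close>-form, normalized so that
  \<open>(\<alpha> \<and> \<beta>)(u, v) = \<alpha>(u) \<beta>(v) - \<alpha>(v) \<beta>(u)\<close> for one-forms.\<close>

definition wedge :: "nat \<Rightarrow> nat \<Rightarrow> ('m, 'e) form \<Rightarrow> ('m, 'e) form \<Rightarrow> ('m, 'e) form" where
  "wedge k l \<omega> \<theta> = (\<lambda>c x v.
     (\<Sum>\<sigma> | \<sigma> permutes {..<k + l}.
        of_int (sign \<sigma>) * \<omega> c x (\<lambda>i. v (\<sigma> i)) * \<theta> c x (\<lambda>i. v (\<sigma> (k + i)))) / (fact k * fact l))"

text \<open>The \<open>m\<close>-fold wedge power of a \<open>k\<close>-form, a form of degree \<open>m * k\<close>.\<close>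

primrec wedge_power :: "nat \<Rightarrow> ('m, 'e) form \<Rightarrow> nat \<Rightarrow> ('m, 'e) form" where
  "wedge_power k \<omega> 0 = of_fun (\<lambda>_. 1)"
| "wedge_power k \<omega> (Suc m) = wedge k (m * k) \<omega> (wedge_power k \<omega> m)"

text \<open>Exterior derivative of a \<open>k\<close>-form:
  \<open>d\<omega>(v\<^sub>0, \<dots>, v\<^sub>k)\<close> is the alternating sum over \<open>i\<close> of the derivatives in direction
  \<open>v\<^sub>i\<close> of \<open>\<omega>\<close> evaluated on the remaining vectors, the \<open>v\<^sub>j\<close> being constant in the chart.\<close>

definition ext_d :: "nat \<Rightarrow> ('m, 'e::euclidean_space) form \<Rightarrow> ('m, 'e) form" where
  "ext_d k \<omega> = (\<lambda>c x v. \<Sum>i\<le>k. (-1) ^ i *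
     frechet_derivative (\<lambda>y. \<omega> c y (\<lambda>j. v (if j < i then j else Suc j))) (at x) (v i))"

definition interior_prod :: "('m, 'e) vfield \<Rightarrow> ('m, 'e) form \<Rightarrow> ('m, 'e) form" where
  "interior_prod X \<omega> = (\<lambda>c x v. \<omega> c x (case_nat (X c x) v))"

text \<open>Lie derivative of a \<open>k\<close>-form. This is
  \<open>X(\<omega>(v\<^sub>0, \<dots>)) - \<Sum>\<^sub>i \<omega>(\<dots>, [X, v\<^sub>i], \<dots>)\<close> for \<open>v\<^sub>i\<close> constant in the chart, where
  \<open>[X, v] = - DX(v)\<close>; equivalently, the derivative at time 0 of the pullback of \<open>\<omega>\<close> by the
  flow of \<open>X\<close>.\<close>

definition lie_deriv ::
    "nat \<Rightarrow> ('m, 'e::euclidean_space) vfield \<Rightarrow> ('m, 'e) form \<Rightarrow> ('m, 'e) form" where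
  "lie_deriv k X \<omega> = (\<lambda>c x v. frechet_derivative (\<lambda>y. \<omega> c y v) (at x) (X c x) +
     (\<Sum>i<k. \<omega> c x (v(i := frechet_derivative (X c) (at x) (v i)))))"

text \<open>The function \<open>X(f)\<close>.\<close>

definition vf_apply ::
    "('m, 'e::euclidean_space) chart set \<Rightarrow> ('m, 'e) vfield \<Rightarrow> ('m \<Rightarrow> real) \<Rightarrow> 'm \<Rightarrow> real" where
  "vf_apply A X f = fun_of A (lie_deriv 0 X (of_fun f))"

section \<open>Contact Hamiltonian systems\<close>

definition contact_volume :: "nat \<Rightarrow> ('m, 'e::euclidean_space) form \<Rightarrow> ('m, 'e) form" where
  "contact_volume n \<eta> = wedge 1 (n * 2) \<eta> (wedge_power 2 (ext_d 1 \<eta>) n)"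

definition contact_form ::
    "('m, 'e::euclidean_space) chart set \<Rightarrow> nat \<Rightarrow> ('m, 'e) form \<Rightarrow> bool" where
  "contact_form A n \<eta> \<longleftrightarrow> diff_form A 1 \<eta> \<and>
     (\<forall>c\<in>A. \<forall>x\<in>chart_target c. \<exists>v. contact_volume n \<eta> c x v \<noteq> 0)"

definition contact_hamiltonian_system ::
    "'m topology \<Rightarrow> ('m, 'e::euclidean_space) chart set \<Rightarrow> nat \<Rightarrow> ('m, 'e) form \<Rightarrow>
     ('m \<Rightarrow> real) \<Rightarrow> bool" where
  "contact_hamiltonian_system M A n \<eta> H \<longleftrightarrow>
     smooth_manifold M A \<and> DIM('e) = 2 * n + 1 \<and> contact_form A n \<eta> \<and> smooth_fun A H"

definition reeb_field ::
    "('m, 'e::euclidean_space) chart set \<Rightarrow> ('m, 'e) form \<Rightarrow> ('m, 'e) vfield \<Rightarrow> bool" where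
  "reeb_field A \<eta> R \<longleftrightarrow> vector_field A R \<and>
     form_eq A (interior_prod R \<eta>) (of_fun (\<lambda>_. 1)) \<and>
     form_eq A (interior_prod R (ext_d 1 \<eta>)) (\<lambda>c x v. 0)"

definition contact_hamiltonian_field ::
    "('m, 'e::euclidean_space) chart set \<Rightarrow> ('m, 'e) form \<Rightarrow> ('m \<Rightarrow> real) \<Rightarrow>
     ('m, 'e) vfield \<Rightarrow> ('m, 'e) vfield \<Rightarrow> bool" where
  "contact_hamiltonian_field A \<eta> H R X \<longleftrightarrow> vector_field A X \<and>
     form_eq A (interior_prod X \<eta>) (of_fun (\<lambda>p. - H p)) \<and>
     form_eq A (interior_prod X (ext_d 1 \<eta>))
       (ext_d 0 (of_fun H) +\<^sub>F (\<lambda>p. - vf_apply A R H p) *\<^sub>F \<eta>)"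

definition conserved ::
    "'m topology \<Rightarrow> ('m, 'e::euclidean_space) chart set \<Rightarrow> ('m, 'e) vfield \<Rightarrow>
     ('m \<Rightarrow> real) \<Rightarrow> bool" where
  "conserved M A X f \<longleftrightarrow> smooth_fun A f \<and> (\<forall>p\<in>topspace M. vf_apply A X f p = 0)"

definition dissipated ::
    "'m topology \<Rightarrow> ('m, 'e::euclidean_space) chart set \<Rightarrow> ('m, 'e) vfield \<Rightarrow>
     ('m \<Rightarrow> real) \<Rightarrow> ('m \<Rightarrow> real) \<Rightarrow> bool" where
  "dissipated M A X a f \<longleftrightarrow>
     smooth_fun A f \<and> (\<forall>p\<in>topspace M. vf_apply A X f p = - a p * f p)"

text \<open>The functions \<open>C\<^sub>1, \<dots>, C\<^bsub>n+1\<^esub>\<close> are the coefficients of the expansion in \<open>t\<close>.\<close>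

definition expansion_coefficients ::
    "('m, 'e::euclidean_space) chart set \<Rightarrow> nat \<Rightarrow> ('m, 'e) form \<Rightarrow> ('m, 'e) form \<Rightarrow>
     (nat \<Rightarrow> 'm \<Rightarrow> real) \<Rightarrow> bool" where
  "expansion_coefficients A n \<eta> \<beta> C \<longleftrightarrow>
     (\<forall>t::real. form_eq A
        (wedge 1 (n * 2) (\<eta> +\<^sub>F (\<lambda>_. t) *\<^sub>F \<beta>)
           (wedge_power 2 (ext_d 1 \<eta> +\<^sub>F (\<lambda>_. t) *\<^sub>F ext_d 1 \<beta>) n))
        ((\<lambda>p. 1 + (\<Sum>j = 1..n + 1. C j p * t ^ j)) *\<^sub>F contact_volume n \<eta>))"

end

theory Submission
  imports Defs
begin

text \<open>Put \<open>\<eta>\<^sub>t = \<eta> + t\<beta>\<close>. From the defining equations, \<open>\<L>\<^sub>X\<eta> = -a\<eta>\<close>, so \<open>\<L>\<^sub>X\<eta>\<^sub>t = -a\<eta>\<^sub>t\<close> for every \<open>t\<close> and hence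
  \<open>\<L>\<^sub>X(d\<eta>\<^sub>t) = -a d\<eta>\<^sub>t - da \<and> \<eta>\<^sub>t\<close>. The last summand is killed by the factor \<open>\<eta>\<^sub>t\<close>, so both
  \<open>\<eta>\<^sub>t \<and> (d\<eta>\<^sub>t)\<^sup>n\<close> and \<open>\<mu>\<close> are multiplied by \<open>-(n+1)a\<close> under \<open>\<L>\<^sub>X\<close>. Their quotient, a polynomial in \<open>t\<close>
  with coefficients \<open>C\<^sub>j\<close>, is therefore conserved for every \<open>t\<close>. Since \<open>X(H) = -aH\<close>, the products
  \<open>HC\<^sub>j\<close> are dissipated.\<close>

section \<open>Smooth maps on open sets\<close>

text \<open>The form \<open>\<eta> + t\<beta>\<close> may degenerate or even vanish at some points,
  so its volume can never be used as a divisor. What rescues the argument is linear algebra: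
  \<open>\<omega> \<and> \<theta>\<close> depends on \<open>\<theta>\<close> only through its
  restriction to the kernel of \<open>\<omega>\<close>, and where \<open>\<omega>\<close> vanishes
  the product is zero anyway. Hence the Lie derivative of \<open>d\<omega>\<close> is computed on
  kernel vectors only, directly in coordinates, from symmetry of second derivatives. Contactness of
  \<open>\<eta>\<close> enters through \<open>\<mu>\<close>: it has no zeros and spans the
  top-degree forms at each point, so in every chart the quotient exists and is a polynomial in
  \<open>t\<close> with smooth coefficients; comparing polynomials for all real \<open>t\<close>
  makes the coefficients independent of the chart and separates the \<open>C\<^sub>j\<close>. The
  claim for \<open>J\<close> does not involve the pencil: because \<open>[X, X] = 0\<close>,
  contracting the equation for \<open>\<L>\<^sub>X\<beta>\<close> with \<open>X\<close> gives
  \<open>X(\<beta>(X)) = -a \<beta>(X)\<close>. Contracting the equation for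
  \<open>d\<eta>(X, -)\<close> with \<open>X\<close> gives \<open>X(H) = -aH\<close>, and adding
  \<open>d(\<eta>(X)) = -dH\<close> to it gives
  \<open>\<L>\<^sub>X\<eta> = -a\<eta>\<close>.\<close>

lemma Ck_on_cong:
  assumes "open S" "\<And>x. x \<in> S \<Longrightarrow> f x = g x" "Ck_on k f S"
  shows "Ck_on k g S"
  using assms(2,3)
proof (induction k arbitrary: f g)
  case 0
  from 0(2) have "continuous_on S f" by simp
  with 0(1) have "continuous_on S g" by (rule continuous_on_eq[rotated])
  then show ?case by simp
next
  case (Suc k)
  have diff: "f differentiable at x" if "x \<in> S" for x
    using Suc.prems(2) that by (simp add: differentiable_on_eq_differentiable_at[OF assms(1)])
  have "frechet_derivative f (at x) = frechet_derivative g (at x)" if "x \<in> S" for x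
    by (rule frechet_derivative_transform_within_open[OF diff[OF that] assms(1) that])
      (simp add: Suc.prems(1))
  moreover have "g differentiable_on S"
    unfolding differentiable_on_eq_differentiable_at[OF assms(1)] differentiable_def
    using diff[unfolded differentiable_def] Suc.prems(1)
      has_derivative_transform_within_open[where s=S and f=f and g=g and t=UNIV] assms(1) by metis
  ultimately show ?case
    using Suc.prems(2) Suc.IH[of "\<lambda>x. frechet_derivative f (at x) v" "\<lambda>x. frechet_derivative g (at x) v" for v]
    by simp
qed

lemma smooth_on_cong:
  assumes "open S" "\<And>x. x \<in> S \<Longrightarrow> f x = g x"
  shows "smooth_on f S \<longleftrightarrow> smooth_on g S"
  unfolding smooth_on_def
  using Ck_on_cong[OF assms(1), of f g] Ck_on_cong[OF assms(1), of g f] assms(2) by auto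

lemma Ck_on_Suc_imp: "Ck_on (Suc k) f S \<Longrightarrow> Ck_on k f S"
  by (induction k arbitrary: f) (auto intro: differentiable_imp_continuous_on)

lemma Ck_on_const: "Ck_on k (\<lambda>x. c) S"
  by (induction k arbitrary: c) auto

lemma Ck_on_imp_differentiable:
  assumes "open S" "Ck_on (Suc k) f S" "x \<in> S"
  shows "f differentiable at x"
  using assms(2,3) by (simp add: differentiable_on_eq_differentiable_at[OF assms(1)])

lemma frechet_derivative_add:
  assumes "f differentiable at x" "g differentiable at x"
  shows "frechet_derivative (\<lambda>x. f x + g x) (at x) v =
    frechet_derivative f (at x) v + frechet_derivative g (at x) v"
  using frechet_derivative_at[OF has_derivative_add[OF assms[unfolded frechet_derivative_works]]]
  by (simp add: fun_eq_iff)

lemma Ck_on_add: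
  assumes "open S" "Ck_on k f S" "Ck_on k g S"
  shows "Ck_on k (\<lambda>x. f x + g x) S"
  using assms(2,3)
proof (induction k arbitrary: f g)
  case 0
  then show ?case by (simp add: continuous_on_add)
next
  case (Suc k)
  note d = Ck_on_imp_differentiable[OF assms(1)]
  have "Ck_on k (\<lambda>x. frechet_derivative (\<lambda>x. f x + g x) (at x) v) S" for v
  proof (rule Ck_on_cong[OF assms(1)])
    show "Ck_on k (\<lambda>x. frechet_derivative f (at x) v + frechet_derivative g (at x) v) S"
      using Suc.prems by (intro Suc.IH) simp_all
    show "frechet_derivative f (at x) v + frechet_derivative g (at x) v =
        frechet_derivative (\<lambda>x. f x + g x) (at x) v" if "x \<in> S" for x
      by (simp add: frechet_derivative_add d[OF Suc.prems(1) that] d[OF Suc.prems(2) that])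
  qed
  then show ?case using Suc.prems by auto
qed

lemma frechet_derivative_diff:
  assumes "f differentiable at x" "g differentiable at x"
  shows "frechet_derivative (\<lambda>x. f x - g x) (at x) v =
    frechet_derivative f (at x) v - frechet_derivative g (at x) v"
  using frechet_derivative_at[OF has_derivative_diff[OF assms[unfolded frechet_derivative_works]]]
  by (simp add: fun_eq_iff)

lemma frechet_derivative_mult:
  fixes f g :: "'a::real_normed_vector \<Rightarrow> real"
  assumes "f differentiable at x" "g differentiable at x"
  shows "frechet_derivative (\<lambda>x. f x * g x) (at x) v =
    f x * frechet_derivative g (at x) v + frechet_derivative f (at x) v * g x"
  using assms
  by (simp add: frechet_derivative_works frechet_derivative_at[OF has_derivative_mult, symmetric])

lemma Ck_on_mult:
  fixes f g :: "'a::euclidean_space \<Rightarrow> real"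
  assumes "open S" "Ck_on k f S" "Ck_on k g S"
  shows "Ck_on k (\<lambda>x. f x * g x) S"
  using assms(2,3)
proof (induction k arbitrary: f g)
  case 0
  then show ?case by (simp add: continuous_on_mult)
next
  case (Suc k)
  note d = Ck_on_imp_differentiable[OF assms(1)]
  have "Ck_on k (\<lambda>x. frechet_derivative (\<lambda>x. f x * g x) (at x) v) S" for v
  proof (rule Ck_on_cong[OF assms(1)])
    show "Ck_on k (\<lambda>x. f x * frechet_derivative g (at x) v + frechet_derivative f (at x) v * g x) S"
      using Suc.prems Suc.prems[THEN Ck_on_Suc_imp]
      by (intro Ck_on_add[OF assms(1)] Suc.IH) simp_all
    show "f x * frechet_derivative g (at x) v + frechet_derivative f (at x) v * g x =
        frechet_derivative (\<lambda>x. f x * g x) (at x) v" if "x \<in> S" for x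
      by (simp add: frechet_derivative_mult d[OF Suc.prems(1) that] d[OF Suc.prems(2) that])
  qed
  moreover have "(\<lambda>x. f x * g x) differentiable_on S"
    using Suc.prems by (simp add: differentiable_on_def differentiable_mult)
  ultimately show ?case by simp
qed

text \<open>The derivative of \<open>1/f\<close> is \<open>-(1/f) f' (1/f)\<close>. It contains
  \<open>1/f\<close> again, but only to one order less, so induction on \<open>k\<close> closes with
  the product rule.\<close>

lemma Ck_on_inverse:
  fixes f :: "'a::euclidean_space \<Rightarrow> real"
  assumes "open S" "Ck_on k f S" "\<And>x. x \<in> S \<Longrightarrow> f x \<noteq> 0"
  shows "Ck_on k (\<lambda>x. inverse (f x)) S"
  using assms(2,3)
proof (induction k)
  case 0
  then show ?case by (simp add: continuous_on_inverse)
next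
  case (Suc k)
  note d = Ck_on_imp_differentiable[OF assms(1) Suc.prems(1)]
  have IH: "Ck_on k (\<lambda>x. inverse (f x)) S"
    using Suc Ck_on_Suc_imp by blast
  have "Ck_on k (\<lambda>x. frechet_derivative (\<lambda>x. inverse (f x)) (at x) v) S" for v
  proof (rule Ck_on_cong[OF assms(1)])
    show "Ck_on k (\<lambda>x. (- 1) * (inverse (f x) * frechet_derivative f (at x) v * inverse (f x))) S"
      using Suc.prems IH by (intro Ck_on_mult[OF assms(1)] Ck_on_const) simp_all
    show "(- 1) * (inverse (f x) * frechet_derivative f (at x) v * inverse (f x)) =
        frechet_derivative (\<lambda>x. inverse (f x)) (at x) v" if "x \<in> S" for x
      using frechet_derivative_at[OF Deriv.has_derivative_inverse[OF Suc.prems(2)[OF that]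
            d[OF that, unfolded frechet_derivative_works]]]
      by (simp add: fun_eq_iff)
  qed
  moreover have "(\<lambda>x. inverse (f x)) differentiable_on S"
    using Suc.prems by (simp add: differentiable_on_def differentiable_inverse)
  ultimately show ?case by auto
qed

lemma Ck_on_linear:
  assumes "bounded_linear h" "open S" "Ck_on k f S"
  shows "Ck_on k (\<lambda>x. h (f x)) S"
  using assms(3)
proof (induction k arbitrary: f)
  case 0
  then show ?case by (simp add: bounded_linear.continuous_on[OF assms(1)])
next
  case (Suc k)
  note d = Ck_on_imp_differentiable[OF assms(2) Suc.prems]
  have der: "((\<lambda>x. h (f x)) has_derivative (\<lambda>v. h (frechet_derivative f (at x) v))) (at x)"
    if "x \<in> S" for x
    by (rule bounded_linear.has_derivative[OF assms(1) d[OF that, unfolded frechet_derivative_works]])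
  have "Ck_on k (\<lambda>x. frechet_derivative (\<lambda>x. h (f x)) (at x) v) S" for v
  proof (rule Ck_on_cong[OF assms(2)])
    show "Ck_on k (\<lambda>x. h (frechet_derivative f (at x) v)) S"
      using Suc.prems by (intro Suc.IH) simp
  qed (metis frechet_derivative_at[OF der])
  moreover have "(\<lambda>x. h (f x)) differentiable_on S"
    unfolding differentiable_on_eq_differentiable_at[OF assms(2)] using differentiableI[OF der] by blast
  ultimately show ?case by auto
qed

lemma smooth_on_const [simp]: "smooth_on (\<lambda>x. c) S"
  by (simp add: smooth_on_def Ck_on_const)

lemma smooth_on_add: "open S \<Longrightarrow> smooth_on f S \<Longrightarrow> smooth_on g S \<Longrightarrow> smooth_on (\<lambda>x. f x + g x) S"
  by (simp add: smooth_on_def Ck_on_add)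

lemma smooth_on_mult:
  fixes f g :: "'a::euclidean_space \<Rightarrow> real"
  shows "open S \<Longrightarrow> smooth_on f S \<Longrightarrow> smooth_on g S \<Longrightarrow> smooth_on (\<lambda>x. f x * g x) S"
  by (simp add: smooth_on_def Ck_on_mult)

lemma smooth_on_uminus:
  fixes f :: "'a::euclidean_space \<Rightarrow> real"
  shows "open S \<Longrightarrow> smooth_on f S \<Longrightarrow> smooth_on (\<lambda>x. - f x) S"
  using smooth_on_mult[of S "\<lambda>_. -1" f] by simp

lemma smooth_on_diff:
  fixes f g :: "'a::euclidean_space \<Rightarrow> real"
  shows "open S \<Longrightarrow> smooth_on f S \<Longrightarrow> smooth_on g S \<Longrightarrow> smooth_on (\<lambda>x. f x - g x) S"
  using smooth_on_add[of S f "\<lambda>x. - g x"] smooth_on_uminus[of S g] by simp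

lemma smooth_on_divide:
  fixes f g :: "'a::euclidean_space \<Rightarrow> real"
  assumes "open S" "smooth_on f S" "smooth_on g S" "\<And>x. x \<in> S \<Longrightarrow> g x \<noteq> 0"
  shows "smooth_on (\<lambda>x. f x / g x) S"
  using assms by (auto simp: smooth_on_def divide_inverse intro!: Ck_on_mult Ck_on_inverse)

lemma smooth_on_sum:
  assumes "open S" "\<And>i. i \<in> I \<Longrightarrow> smooth_on (f i) S"
  shows "smooth_on (\<lambda>x. \<Sum>i\<in>I. f i x) S"
  using assms(2) by (induction I rule: infinite_finite_induct) (auto intro: smooth_on_add[OF assms(1)])

lemma smooth_on_inner:
  fixes f :: "'a::euclidean_space \<Rightarrow> 'b::euclidean_space"
  shows "open S \<Longrightarrow> smooth_on f S \<Longrightarrow> smooth_on (\<lambda>x. f x \<bullet> b) S"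
  by (simp add: smooth_on_def Ck_on_linear[OF bounded_linear_inner_left])

lemma smooth_on_frechet_derivative:
  "smooth_on f S \<Longrightarrow> smooth_on (\<lambda>x. frechet_derivative f (at x) v) S"
  unfolding smooth_on_def using Ck_on.simps(2) by blast

lemma smooth_on_imp_differentiable:
  "open S \<Longrightarrow> smooth_on f S \<Longrightarrow> x \<in> S \<Longrightarrow> f differentiable at x"
  using Ck_on_imp_differentiable smooth_on_def by blast

lemma smooth_on_imp_has_derivative:
  "open S \<Longrightarrow> smooth_on f S \<Longrightarrow> x \<in> S \<Longrightarrow> (f has_derivative frechet_derivative f (at x)) (at x)"
  using smooth_on_imp_differentiable frechet_derivative_works by blast

text \<open>Both functions have the same derivatives at \<open>x\<close>, so the choice operator
  behind \<open>frechet_derivative\<close> selects the same map, also where no derivative exists.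
  This permits rewriting under a derivative with identities that hold only on a chart
  target.\<close>

lemma frechet_derivative_cong_open:
  assumes "open S" "x \<in> S" "\<And>y. y \<in> S \<Longrightarrow> f y = g y"
  shows "frechet_derivative f (at x) = frechet_derivative g (at x)"
proof -
  have "(f has_derivative F) (at x) \<longleftrightarrow> (g has_derivative F) (at x)" for F
    using has_derivative_transform_within_open[of f F x UNIV S g]
      has_derivative_transform_within_open[of g F x UNIV S f] assms by auto
  then show ?thesis by (simp add: frechet_derivative_def)
qed

section \<open>Linear functionals evaluated at a moving vector\<close>

lemma linear_Basis_expansion:
  fixes f :: "'a::euclidean_space \<Rightarrow> 'b::real_vector"
  assumes "linear f"
  shows "f u = (\<Sum>b\<in>Basis. (u \<bullet> b) *\<^sub>R f b)"
  using linear_sum[OF assms] linear_scale[OF assms] euclidean_representation[of u] by (metis (no_types, lifting) sum.cong)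

text \<open>Smoothness of \<open>f\<close> is known only for each fixed vector; expanding
  \<open>g x\<close> in the basis reduces the moving argument to finitely many fixed ones.\<close>

lemma smooth_on_pairing:
  fixes f :: "'a::euclidean_space \<Rightarrow> 'b::euclidean_space \<Rightarrow> real"
  assumes "open S" "\<And>x. x \<in> S \<Longrightarrow> linear (f x)" "\<And>u. smooth_on (\<lambda>x. f x u) S" "smooth_on g S"
  shows "smooth_on (\<lambda>x. f x (g x)) S"
proof -
  have "smooth_on (\<lambda>x. \<Sum>b\<in>Basis. (g x \<bullet> b) * f x b) S"
    by (intro smooth_on_sum smooth_on_mult smooth_on_inner assms)
  then show ?thesis
    by (subst smooth_on_cong[OF assms(1), where g="\<lambda>x. \<Sum>b\<in>Basis. (g x \<bullet> b) * f x b"])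
      (auto simp: linear_Basis_expansion[OF assms(2)])
qed

text \<open>A product rule: one term differentiates the functional with the vector frozen at
  \<open>g x\<close>, the other moves the vector. The inner map \<open>h\<close> is there for
  pullbacks along transition maps.\<close>

lemma has_derivative_pairing:
  fixes f :: "'a::euclidean_space \<Rightarrow> 'b::euclidean_space \<Rightarrow> real"
  assumes f: "(h has_derivative h') (at x)" "\<And>u. (\<lambda>y. f y u) differentiable at (h x)"
    and lin: "open S" "x \<in> S" "\<And>y. y \<in> S \<Longrightarrow> linear (f (h y))"
    and g: "(g has_derivative g') (at x)"
  shows "((\<lambda>y. f (h y) (g y)) has_derivative
    (\<lambda>v. frechet_derivative (\<lambda>y. f y (g x)) (at (h x)) (h' v) + f (h x) (g' v))) (at x)"
proof -
  let ?D = "\<lambda>u. frechet_derivative (\<lambda>y. f y u) (at (h x))"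
  have fd: "((\<lambda>y. f y u) has_derivative ?D u) (at (h x))" for u
    using f(2) frechet_derivative_works by blast
  have comp: "((\<lambda>y. f (h y) u) has_derivative (\<lambda>v. ?D u (h' v))) (at x)" for u
    using has_derivative_compose[OF f(1) fd] .
  have sums: "((\<lambda>y. \<Sum>b\<in>Basis. (g y \<bullet> b) * f (h y) b) has_derivative
      (\<lambda>v. \<Sum>b\<in>Basis. (g x \<bullet> b) * ?D b (h' v) + (g' v \<bullet> b) * f (h x) b)) (at x)"
    by (intro has_derivative_sum has_derivative_mult comp has_derivative_inner_left g)
  \<comment> \<open>Linearity of \<open>f\<close> is available only at the points
    \<open>h y\<close>, so the expansion of \<open>?D (g x)\<close> is obtained along the vectors
    \<open>h' v\<close>, by uniqueness of the derivative of the composite.\<close>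
  have "((\<lambda>y. f (h y) (g x)) has_derivative (\<lambda>v. \<Sum>b\<in>Basis. (g x \<bullet> b) * ?D b (h' v))) (at x)"
  proof (rule has_derivative_transform_within_open[OF _ lin(1,2)])
    show "((\<lambda>y. \<Sum>b\<in>Basis. (g x \<bullet> b) * f (h y) b) has_derivative
      (\<lambda>v. \<Sum>b\<in>Basis. (g x \<bullet> b) * ?D b (h' v))) (at x)"
      by (intro has_derivative_sum has_derivative_mult_right comp)
  qed (simp add: linear_Basis_expansion[OF lin(3), of _ "g x"])
  from has_derivative_unique[OF this comp]
  have D: "?D (g x) (h' v) = (\<Sum>b\<in>Basis. (g x \<bullet> b) * ?D b (h' v))" for v
    by metis
  have eq: "(\<Sum>b\<in>Basis. (g x \<bullet> b) * ?D b (h' v) + (g' v \<bullet> b) * f (h x) b) =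
      ?D (g x) (h' v) + f (h x) (g' v)" for v
    by (simp add: sum.distrib D linear_Basis_expansion[OF lin(3)[OF lin(2)], of "g' v"])
  show ?thesis
    by (rule has_derivative_transform_within_open[OF sums[unfolded eq] lin(1,2)])
      (simp add: linear_Basis_expansion[OF lin(3), of _ "g _"])
qed

lemma frechet_derivative_pairing:
  fixes f :: "'a::euclidean_space \<Rightarrow> 'b::euclidean_space \<Rightarrow> real"
  assumes "open S" "x \<in> S" "\<And>y. y \<in> S \<Longrightarrow> linear (f y)" "\<And>u. smooth_on (\<lambda>y. f y u) S" "smooth_on g S"
  shows "frechet_derivative (\<lambda>y. f y (g y)) (at x) v =
    frechet_derivative (\<lambda>y. f y (g x)) (at x) v + f x (frechet_derivative g (at x) v)"
  using has_derivative_pairing[where h="\<lambda>y. y" and h'="\<lambda>v. v" and f=f and g=g and x=x and S=S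
      and g'="frechet_derivative g (at x)"] assms
  by (auto dest!: frechet_derivative_at simp: smooth_on_imp_has_derivative smooth_on_imp_differentiable
      fun_eq_iff has_derivative_ident)

section \<open>Symmetry of second derivatives\<close>

lemma mean_value_along_ray:
  fixes f :: "'a::real_normed_vector \<Rightarrow> real"
  assumes "0 < s" "\<And>r. 0 \<le> r \<Longrightarrow> r \<le> s \<Longrightarrow> f differentiable at (x + r *\<^sub>R p)"
  obtains r where "0 < r" "r < s"
    "f (x + s *\<^sub>R p) - f x = s * frechet_derivative f (at (x + r *\<^sub>R p)) p"
proof -
  have "((\<lambda>r. f (x + r *\<^sub>R p)) has_real_derivative frechet_derivative f (at (x + r *\<^sub>R p)) p) (at r)"
    if "0 \<le> r" "r \<le> s" for r
  proof -
    have F: "(f has_derivative frechet_derivative f (at (x + r *\<^sub>R p))) (at (x + r *\<^sub>R p))"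
      using assms(2)[OF that] frechet_derivative_works by blast
    have line: "((\<lambda>r. x + r *\<^sub>R p) has_derivative (\<lambda>h. h *\<^sub>R p)) (at r)"
      by (auto intro!: derivative_eq_intros)
    have "(\<lambda>h. frechet_derivative f (at (x + r *\<^sub>R p)) (h *\<^sub>R p)) =
        (*) (frechet_derivative f (at (x + r *\<^sub>R p)) p)"
      by (simp add: fun_eq_iff linear_scale[OF has_derivative_linear[OF F]])
    then show ?thesis
      using has_derivative_compose[OF line F] unfolding has_field_derivative_def by simp
  qed
  from MVT2[OF assms(1) this] show ?thesis using that by auto
qed

text \<open>Two uses of the mean value theorem: in direction \<open>p\<close> for the increment
  \<open>f (y + s q) - f y\<close>, then in direction \<open>q\<close> for the
  \<open>p\<close>-derivative of \<open>f\<close>. The left-hand side is symmetric in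
  \<open>p\<close> and \<open>q\<close>, while the right-hand side sees one order of
  differentiation.\<close>

lemma second_difference:
  fixes f :: "'a::euclidean_space \<Rightarrow> real"
  assumes "open S" "smooth_on f S" "0 < s" "\<And>r r'. \<lbrakk>0 \<le> r; r \<le> s; 0 \<le> r'; r' \<le> s\<rbrakk> \<Longrightarrow> x + r *\<^sub>R p + r' *\<^sub>R q \<in> S"
  obtains r r' where "0 < r" "r < s" "0 < r'" "r' < s"
    "f (x + s *\<^sub>R p + s *\<^sub>R q) - f (x + s *\<^sub>R p) - f (x + s *\<^sub>R q) + f x =
     s * (s * frechet_derivative (\<lambda>y. frechet_derivative f (at y) p) (at (x + r *\<^sub>R p + r' *\<^sub>R q)) q)"
proof -
  have 0: "(\<lambda>y. f (y + s *\<^sub>R q)) differentiable at (x + r *\<^sub>R p) \<and>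
      frechet_derivative (\<lambda>y. f (y + s *\<^sub>R q)) (at (x + r *\<^sub>R p)) =
      frechet_derivative f (at (x + r *\<^sub>R p + s *\<^sub>R q))" if "0 \<le> r" "r \<le> s" for r
  proof -
    have "(f has_derivative frechet_derivative f (at (x + r *\<^sub>R p + s *\<^sub>R q))) (at (x + r *\<^sub>R p + s *\<^sub>R q))"
      using assms that by (intro smooth_on_imp_has_derivative[OF assms(1,2)]) auto
    moreover have "((\<lambda>y. y + s *\<^sub>R q) has_derivative (\<lambda>v. v)) (at (x + r *\<^sub>R p))"
      by (auto intro!: derivative_eq_intros)
    ultimately have "((\<lambda>y. f (y + s *\<^sub>R q)) has_derivative
        frechet_derivative f (at (x + r *\<^sub>R p + s *\<^sub>R q))) (at (x + r *\<^sub>R p))"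
      using has_derivative_compose by blast
    then show ?thesis using differentiableI frechet_derivative_at by metis
  qed
  have 1: "f differentiable at (x + r *\<^sub>R p)" if "0 \<le> r" "r \<le> s" for r
    using assms(4)[of r 0] that assms(3) by (auto intro: smooth_on_imp_differentiable[OF assms(1,2)])
  obtain r where r: "0 < r" "r < s" and
    e1: "(f (x + s *\<^sub>R p + s *\<^sub>R q) - f (x + s *\<^sub>R p)) - (f (x + s *\<^sub>R q) - f x) =
      s * frechet_derivative (\<lambda>y. f (y + s *\<^sub>R q) - f y) (at (x + r *\<^sub>R p)) p"
    by (rule mean_value_along_ray[OF assms(3), where f="\<lambda>y. f (y + s *\<^sub>R q) - f y" and x=x and p=p])
      (use 0 1 in auto)
  have e2: "frechet_derivative (\<lambda>y. f (y + s *\<^sub>R q) - f y) (at (x + r *\<^sub>R p)) p =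
     frechet_derivative f (at (x + r *\<^sub>R p + s *\<^sub>R q)) p - frechet_derivative f (at (x + r *\<^sub>R p)) p"
    using 0[of r] 1[of r] r by (simp add: frechet_derivative_diff)
  obtain r' where r': "0 < r'" "r' < s" and
    e3: "frechet_derivative f (at (x + r *\<^sub>R p + s *\<^sub>R q)) p - frechet_derivative f (at (x + r *\<^sub>R p)) p =
      s * frechet_derivative (\<lambda>y. frechet_derivative f (at y) p) (at (x + r *\<^sub>R p + r' *\<^sub>R q)) q"
  proof (rule mean_value_along_ray[OF assms(3), where f="\<lambda>y. frechet_derivative f (at y) p" and x="x + r *\<^sub>R p" and p=q])
    show "(\<lambda>y. frechet_derivative f (at y) p) differentiable at (x + r *\<^sub>R p + r' *\<^sub>R q)"
      if "0 \<le> r'" "r' \<le> s" for r'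
      using assms r that by (intro smooth_on_imp_differentiable[OF assms(1)] smooth_on_frechet_derivative) auto
  qed auto
  show ?thesis
    using that[OF r r'] e1 e2 e3 by (simp add: algebra_simps)
qed

text \<open>The symmetric second difference equals \<open>s * s\<close> times either mixed
  derivative, each at its own point of a small parallelogram at \<open>x\<close>. So the two mixed
  derivatives share a value arbitrarily close to \<open>x\<close>, and continuity forbids a gap
  there.\<close>

lemma symmetric_second_derivative_real:
  fixes f :: "'a::euclidean_space \<Rightarrow> real"
  assumes S: "open S" "x \<in> S" and f: "smooth_on f S"
  shows "frechet_derivative (\<lambda>y. frechet_derivative f (at y) p) (at x) q =
    frechet_derivative (\<lambda>y. frechet_derivative f (at y) q) (at x) p" (is "?G p q x = ?G q p x")
proof (rule ccontr)
  assume ne: "?G p q x \<noteq> ?G q p x"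
  \<comment> \<open>Half the gap: a common value within \<open>e\<close> of both mixed derivatives
    at \<open>x\<close> would contradict the triangle inequality.\<close>
  define e where "e = \<bar>?G p q x - ?G q p x\<bar> / 2"
  have e: "e > 0" using ne by (simp add: e_def)
  have cont: "continuous (at x) (?G p q)" for p q
    using smooth_on_imp_differentiable[OF S(1) _ S(2)] f
    by (intro differentiable_imp_continuous_within) (auto intro: smooth_on_frechet_derivative)
  obtain d1 where d1: "d1 > 0" "ball x d1 \<subseteq> S" using S open_contains_ball by blast
  obtain d2 where d2: "d2 > 0" "\<And>y. dist y x < d2 \<Longrightarrow> dist (?G p q y) (?G p q x) < e"
    using cont[of p q] e unfolding continuous_at_eps_delta by blast
  obtain d3 where d3: "d3 > 0" "\<And>y. dist y x < d3 \<Longrightarrow> dist (?G q p y) (?G q p x) < e"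
    using cont[of q p] e unfolding continuous_at_eps_delta by blast
  define d where "d = min d1 (min d2 d3)"
  \<comment> \<open>Chosen so that the parallelogram with sides \<open>s p\<close> and
    \<open>s q\<close> stays within distance \<open>d\<close> of \<open>x\<close>; the summand 1
    covers \<open>p = q = 0\<close>.\<close>
  define s where "s = d / (norm p + norm q + 1)"
  have d: "d > 0" using d1 d2 d3 by (simp add: d_def)
  have pos: "norm p + norm q + 1 > 0"
    using norm_ge_zero[of p] norm_ge_zero[of q] by linarith
  have s: "s > 0" using d pos by (simp add: s_def)
  have near: "dist (x + r *\<^sub>R p + r' *\<^sub>R q) x < d" if "0 \<le> r" "r \<le> s" "0 \<le> r'" "r' \<le> s" for r r'
  proof -
    have "dist (x + r *\<^sub>R p + r' *\<^sub>R q) x \<le> r * norm p + r' * norm q"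
      using norm_triangle_ineq[of "r *\<^sub>R p" "r' *\<^sub>R q"] that by (simp add: dist_norm add.assoc)
    also have "\<dots> \<le> s * norm p + s * norm q"
      using that by (intro add_mono mult_right_mono) auto
    also have "\<dots> < s * (norm p + norm q + 1)" using s by (simp add: algebra_simps)
    also have "\<dots> = d" using pos by (simp add: s_def)
    finally show ?thesis .
  qed
  have inS: "x + r *\<^sub>R p + r' *\<^sub>R q \<in> S" "x + r *\<^sub>R q + r' *\<^sub>R p \<in> S"
    if "0 \<le> r" "r \<le> s" "0 \<le> r'" "r' \<le> s" for r r'
  proof -
    have *: "y \<in> S" if "dist y x < d" for y
      using that d1(2) by (auto simp: d_def dist_commute subset_iff)
    show "x + r *\<^sub>R p + r' *\<^sub>R q \<in> S"
      by (rule *[OF near[OF that]])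
    have "x + r *\<^sub>R q + r' *\<^sub>R p = x + r' *\<^sub>R p + r *\<^sub>R q" by simp
    then show "x + r *\<^sub>R q + r' *\<^sub>R p \<in> S"
      using *[OF near[OF that(3,4,1,2)]] by metis
  qed
  obtain r r' where r: "0 < r" "r < s" "0 < r'" "r' < s"
    "f (x + s *\<^sub>R p + s *\<^sub>R q) - f (x + s *\<^sub>R p) - f (x + s *\<^sub>R q) + f x =
     s * (s * ?G p q (x + r *\<^sub>R p + r' *\<^sub>R q))"
    by (rule second_difference[OF S(1) f s inS(1)]; (assumption | rule that; assumption))
  obtain u u' where u: "0 < u" "u < s" "0 < u'" "u' < s"
    "f (x + s *\<^sub>R q + s *\<^sub>R p) - f (x + s *\<^sub>R q) - f (x + s *\<^sub>R p) + f x =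
     s * (s * ?G q p (x + u *\<^sub>R q + u' *\<^sub>R p))"
    by (rule second_difference[OF S(1) f s inS(2)]; (assumption | rule that; assumption))
  have "s * (s * ?G p q (x + r *\<^sub>R p + r' *\<^sub>R q)) = s * (s * ?G q p (x + u' *\<^sub>R p + u *\<^sub>R q))"
  proof -
    have "x + s *\<^sub>R q + s *\<^sub>R p = x + s *\<^sub>R p + s *\<^sub>R q" "x + u *\<^sub>R q + u' *\<^sub>R p = x + u' *\<^sub>R p + u *\<^sub>R q"
      by simp_all
    note eq = this
    have "f (x + s *\<^sub>R p + s *\<^sub>R q) - f (x + s *\<^sub>R p) - f (x + s *\<^sub>R q) + f x =
        s * (s * ?G q p (x + u' *\<^sub>R p + u *\<^sub>R q))"
      using u(5) unfolding eq by linarith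
    then show ?thesis using r(5) by linarith
  qed
  then have "?G p q (x + r *\<^sub>R p + r' *\<^sub>R q) = ?G q p (x + u' *\<^sub>R p + u *\<^sub>R q)"
    using s by simp
  moreover have "dist (?G p q (x + r *\<^sub>R p + r' *\<^sub>R q)) (?G p q x) < e"
    using near[of r r'] r by (intro d2(2)) (auto simp: d_def)
  moreover have "dist (?G q p (x + u' *\<^sub>R p + u *\<^sub>R q)) (?G q p x) < e"
    using near[of u' u] u by (intro d3(2)) (auto simp: d_def)
  ultimately show False
    using dist_triangle3[of "?G p q x" "?G q p x" "?G p q (x + r *\<^sub>R p + r' *\<^sub>R q)"]
    unfolding e_def dist_real_def[symmetric] by simp
qed

lemma symmetric_second_derivative:
  fixes f :: "'a::euclidean_space \<Rightarrow> 'b::euclidean_space"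
  assumes S: "open S" "x \<in> S" and f: "smooth_on f S"
  shows "frechet_derivative (\<lambda>y. frechet_derivative f (at y) p) (at x) q =
    frechet_derivative (\<lambda>y. frechet_derivative f (at y) q) (at x) p"
proof (rule euclidean_eqI)
  fix b :: 'b
  have inner: "frechet_derivative (\<lambda>y. g y \<bullet> b) (at y) v = frechet_derivative g (at y) v \<bullet> b"
    if "smooth_on g S" "y \<in> S" for g :: "'a \<Rightarrow> 'b" and y v
    using smooth_on_imp_has_derivative[OF S(1) that]
    by (simp add: frechet_derivative_at[OF has_derivative_inner_left, symmetric])
  have "frechet_derivative (\<lambda>y. frechet_derivative f (at y) p) (at x) q \<bullet> b =
    frechet_derivative (\<lambda>y. frechet_derivative (\<lambda>z. f z \<bullet> b) (at y) p) (at x) q" for p q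
    by (simp add: inner[OF smooth_on_frechet_derivative[OF f] S(2), symmetric]
        frechet_derivative_cong_open[OF S inner[OF f]])
  then show "frechet_derivative (\<lambda>y. frechet_derivative f (at y) p) (at x) q \<bullet> b =
      frechet_derivative (\<lambda>y. frechet_derivative f (at y) q) (at x) p \<bullet> b"
    using symmetric_second_derivative_real[OF S smooth_on_inner[OF S(1) f]] by metis
qed

section \<open>Alternating forms and wedge products\<close>

lemma alternating_form_local:
  "alternating_form k \<alpha> \<Longrightarrow> (\<And>i. i < k \<Longrightarrow> v i = w i) \<Longrightarrow> \<alpha> v = \<alpha> w"
  unfolding alternating_form_def by blast

lemma alternating_form_linear:
  "alternating_form k \<alpha> \<Longrightarrow> i < k \<Longrightarrow> linear (\<lambda>u. \<alpha> (v(i := u)))"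
  unfolding alternating_form_def by blast

lemma alternating_form_zero:
  "alternating_form k \<alpha> \<Longrightarrow> i < k \<Longrightarrow> j < k \<Longrightarrow> i \<noteq> j \<Longrightarrow> v i = v j \<Longrightarrow> \<alpha> v = 0"
  unfolding alternating_form_def by blast

lemma alternating_form_cmult: "alternating_form k \<alpha> \<Longrightarrow> alternating_form k (\<lambda>v. c * \<alpha> v)"
  unfolding alternating_form_def by (auto intro!: linear_compose_scale_right[where 'b=real, unfolded real_scaleR_def])

lemma alternating_form_add:
  "alternating_form k \<alpha> \<Longrightarrow> alternating_form k \<alpha>' \<Longrightarrow> alternating_form k (\<lambda>v. \<alpha> v + \<alpha>' v)"
  unfolding alternating_form_def
  by (simp add: linear_compose_add) metis

text \<open>Polarisation: the value with \<open>a + b\<close> in both slots is zero, and so are the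
  two diagonal terms of its expansion.\<close>

lemma alternating_form_swap:
  assumes "alternating_form k \<alpha>" "i < k" "j < k" "i \<noteq> j"
  shows "\<alpha> (v(i := a, j := b)) = - \<alpha> (v(i := b, j := a))"
proof -
  have lin1: "\<alpha> (v(i := p + q, j := r)) = \<alpha> (v(i := p, j := r)) + \<alpha> (v(i := q, j := r))" for p q r
    using linear_add[OF alternating_form_linear[OF assms(1,2), of "v(j := r)"]] assms(4)
    by (simp add: fun_upd_twist)
  have lin2: "\<alpha> (v(i := r, j := p + q)) = \<alpha> (v(i := r, j := p)) + \<alpha> (v(i := r, j := q))" for p q r
    using linear_add[OF alternating_form_linear[OF assms(1,3), of "v(i := r)"]] by simp
  have zero: "\<alpha> (v(i := r, j := r)) = 0" for r
    by (rule alternating_form_zero[OF assms]) (use assms(4) in simp)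
  show ?thesis
    using zero[of "a + b"] unfolding lin1 lin2 by (simp add: zero)
qed

text \<open>Each transposition only flips the sign, so vanishing survives a product of
  transpositions and no sign has to be tracked.\<close>

lemma alternating_form_permute_eq_0:
  assumes "alternating_form k \<alpha>" "\<alpha> e = 0" "\<sigma> permutes {..<k}"
  shows "\<alpha> (\<lambda>i. e (\<sigma> i)) = 0"
  using finite_lessThan[of k] assms(3)
proof (induction rule: permutes_rev_induct)
  case id
  then show ?case using assms(2) by simp
next
  case (swap a b p)
  then have "(\<lambda>i. e ((p \<circ> Transposition.transpose a b) i)) = (\<lambda>i. e (p i))(a := e (p b), b := e (p a))"
    by (auto simp: Transposition.transpose_def fun_eq_iff)
  moreover have "(\<lambda>i. e (p i))(a := e (p a), b := e (p b)) = (\<lambda>i. e (p i))"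
    by auto
  ultimately show ?case
    using swap alternating_form_swap[OF assms(1), of a b "\<lambda>i. e (p i)" "e (p b)" "e (p a)"] by simp
qed

text \<open>By multilinearity only tuples of basis vectors matter. Such a tuple either repeats a
  vector, or has as many distinct entries as the basis and is a permutation of
  \<open>e\<close>.\<close>

lemma alternating_form_top_eq_0:
  fixes \<alpha> :: "(nat \<Rightarrow> 'e::euclidean_space) \<Rightarrow> real"
  assumes alt: "alternating_form DIM('e) \<alpha>" and e: "bij_betw e {..<DIM('e)} Basis" "\<alpha> e = 0"
  shows "\<alpha> v = 0"
proof -
  have basis: "\<alpha> w = 0" if w: "\<And>i. i < DIM('e) \<Longrightarrow> w i \<in> Basis" for w
  proof (cases "inj_on w {..<DIM('e)}")
    case True
    \<comment> \<open>The permutation with \<open>w = e \<circ> \<sigma>\<close> on the relevant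
      slots, extended by the identity as \<open>permutes\<close> demands.\<close>
    define \<sigma> where "\<sigma> i = (if i < DIM('e) then inv_into {..<DIM('e)} e (w i) else i)" for i
    have bw: "bij_betw w {..<DIM('e)} Basis"
      unfolding bij_betw_def
    proof
      show "w ` {..<DIM('e)} = Basis"
        using w by (intro card_subset_eq) (auto simp: card_image[OF True])
    qed (rule True)
    have "bij_betw (inv_into {..<DIM('e)} e \<circ> w) {..<DIM('e)} {..<DIM('e)}"
      using bij_betw_trans[OF bw bij_betw_inv_into[OF e(1)]] .
    then have "bij_betw \<sigma> {..<DIM('e)} {..<DIM('e)}"
      by (rule bij_betw_cong[THEN iffD1, rotated]) (simp add: \<sigma>_def)
    then have "\<sigma> permutes {..<DIM('e)}"
      by (rule bij_imp_permutes) (simp add: \<sigma>_def)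
    then have "\<alpha> (\<lambda>i. e (\<sigma> i)) = 0"
      using alternating_form_permute_eq_0[OF alt e(2)] by blast
    moreover have "\<alpha> w = \<alpha> (\<lambda>i. e (\<sigma> i))"
      using w e(1) by (intro alternating_form_local[OF alt]) (simp add: \<sigma>_def bij_betw_inv_into_right)
    ultimately show ?thesis by simp
  next
    case False
    then show ?thesis using alternating_form_zero[OF alt] by (auto simp: inj_on_def)
  qed
  \<comment> \<open>Induction on the number \<open>m\<close> of leading slots that may hold
    arbitrary vectors; the step expands the last of them in the basis.\<close>
  have "\<alpha> w = 0" if "\<And>i. m \<le> i \<Longrightarrow> i < DIM('e) \<Longrightarrow> w i \<in> Basis" "m \<le> DIM('e)" for w m
    using that
  proof (induction m arbitrary: w)
    case 0
    then show ?case using basis by simp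
  next
    case (Suc m)
    have lin: "linear (\<lambda>u. \<alpha> (w(m := u)))"
      using Suc.prems by (intro alternating_form_linear[OF alt]) simp
    have "\<alpha> (w(m := b)) = 0" if "b \<in> Basis" for b
      using Suc.prems that by (intro Suc.IH) auto
    then have "\<alpha> (w(m := w m)) = 0"
      using linear_Basis_expansion[OF lin, of "w m"] by simp
    then show ?case by simp
  qed
  from this[of "DIM('e)"] show ?thesis by simp
qed

text \<open>Top-degree forms span a line: the combination
  \<open>\<alpha> e * \<mu> - \<mu> e * \<alpha>\<close> vanishes on the ordered basis
  \<open>e\<close>, hence everywhere. The cross-multiplied form avoids dividing by either
  value.\<close>

lemma alternating_form_top_proportional:
  fixes \<alpha> \<mu> :: "(nat \<Rightarrow> 'e::euclidean_space) \<Rightarrow> real"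
  assumes "alternating_form DIM('e) \<alpha>" "alternating_form DIM('e) \<mu>"
    and "bij_betw e {..<DIM('e)} Basis"
  shows "\<alpha> e * \<mu> v = \<mu> e * \<alpha> v"
proof -
  have "alternating_form DIM('e) (\<lambda>v. \<alpha> e * \<mu> v + (- \<mu> e) * \<alpha> v)"
    using assms by (intro alternating_form_add alternating_form_cmult)
  from alternating_form_top_eq_0[OF this assms(3), of v] show ?thesis by simp
qed

text \<open>Changing one slot at a time, each correction term carries \<open>v j\<close> in two
  slots and is zero. In \<open>?w m\<close> the slots below \<open>m\<close> have been
  changed.\<close>

lemma alternating_form_shear:
  assumes "alternating_form k \<alpha>" "j < k"
  shows "\<alpha> (\<lambda>i. if i = j then v i else v i - r i *\<^sub>R v j) = \<alpha> v"
proof -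
  let ?w = "\<lambda>m i. if i < m \<and> i \<noteq> j then v i - r i *\<^sub>R v j else v i"
  have "\<alpha> (?w m) = \<alpha> v" if "m \<le> k" for m
    using that
  proof (induction m)
    case (Suc m)
    show ?case
    proof (cases "m = j")
      case True
      then have "?w (Suc m) = ?w m" by (auto simp: fun_eq_iff less_Suc_eq)
      with Suc show ?thesis by simp
    next
      case False
      have lin: "linear (\<lambda>u. \<alpha> ((?w m)(m := u)))"
        using Suc.prems by (intro alternating_form_linear[OF assms(1)]) simp
      have "\<alpha> ((?w m)(m := v j)) = 0"
        using Suc.prems assms(2) False by (intro alternating_form_zero[OF assms(1), of m j]) auto
      moreover have "?w (Suc m) = (?w m)(m := v m - r m *\<^sub>R v j)" "?w m = (?w m)(m := v m)"
        using False by (auto simp: fun_eq_iff less_Suc_eq)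
      ultimately have "\<alpha> (?w (Suc m)) = \<alpha> (?w m)"
        using linear_diff[OF lin, of "v m" "r m *\<^sub>R v j"] linear_scale[OF lin, of "r m" "v j"] by simp
      with Suc show ?thesis by simp
    qed
  qed simp
  moreover have "\<alpha> (\<lambda>i. if i = j then v i else v i - r i *\<^sub>R v j) = \<alpha> (?w k)"
    by (rule alternating_form_local[OF assms(1)]) auto
  ultimately show ?thesis by simp
qed

text \<open>If some \<open>v\<^sub>j\<close> is not in the kernel of \<open>\<omega>\<close>, subtracting multiples of it moves all other arguments into the
  kernel without changing the value of the wedge product.\<close>

lemma wedge_eq_0_if_kernel:
  assumes alt: "alternating_form (1 + l) (wedge 1 l \<omega> \<theta> c x)"
    and \<omega>: "alternating_form 1 (\<omega> c x)"
    and ker: "\<And>v. (\<And>i. \<omega> c x (\<lambda>_. v i) = 0) \<Longrightarrow> \<theta> c x v = 0"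
  shows "wedge 1 l \<omega> \<theta> c x v = 0"
proof -
  have first: "\<omega> c x w = \<omega> c x (\<lambda>_. w 0)" for w
    by (rule alternating_form_local[OF \<omega>]) simp
  have lin: "linear (\<lambda>u. \<omega> c x (\<lambda>_. u))"
    using alternating_form_linear[OF \<omega>, of 0 v] first[of "v(0 := _)"] by simp
  show ?thesis
  proof (cases "\<exists>j<1 + l. \<omega> c x (\<lambda>_. v j) \<noteq> 0")
    \<comment> \<open>All relevant arguments lie in the kernel, so every summand has a zero factor
      from \<open>\<omega>\<close>. This includes the points where \<open>\<omega>\<close> itself
      vanishes.\<close>
    case False
    have "\<omega> c x (\<lambda>i. v (\<sigma> i)) = 0" if "\<sigma> permutes {..<1 + l}" for \<sigma>
      using False permutes_in_image[OF that, of 0] first[of "\<lambda>i. v (\<sigma> i)"] by simp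
    then show ?thesis by (simp add: wedge_def)
  next
    case True
    then obtain j where j: "j < 1 + l" "\<omega> c x (\<lambda>_. v j) \<noteq> 0" by blast
    define r where "r i = \<omega> c x (\<lambda>_. v i) / \<omega> c x (\<lambda>_. v j)" for i
    define w where "w = (\<lambda>i. if i = j then v i else v i - r i *\<^sub>R v j)"
    have w: "\<omega> c x (\<lambda>_. w i) = 0" if "i \<noteq> j" for i
      using that j(2) by (simp add: w_def r_def linear_diff[OF lin] linear_scale[OF lin])
    \<comment> \<open>Only \<open>w j\<close> lies outside the kernel. If it is the argument of
      \<open>\<omega>\<close>, injectivity of \<open>\<sigma>\<close> leaves kernel vectors for
      \<open>\<theta>\<close>; otherwise \<open>\<omega>\<close> receives a kernel vector.\<close>
    have "\<omega> c x (\<lambda>i. w (\<sigma> i)) * \<theta> c x (\<lambda>i. w (\<sigma> (1 + i))) = 0" if "\<sigma> permutes {..<1 + l}" for \<sigma>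
    proof (cases "\<sigma> 0 = j")
      case True
      then have "\<sigma> (1 + i) \<noteq> j" for i
        using permutes_inj[OF that] by (metis add_is_0 injD zero_neq_one)
      then show ?thesis using ker[of "\<lambda>i. w (\<sigma> (1 + i))"] w by simp
    next
      case False
      then show ?thesis using first[of "\<lambda>i. w (\<sigma> i)"] w by simp
    qed
    then have "wedge 1 l \<omega> \<theta> c x w = 0"
      unfolding wedge_def mult.assoc by (simp add: sum.neutral)
    then show ?thesis
      using alternating_form_shear[OF alt j(1), of v r] by (simp add: w_def)
  qed
qed

text \<open>In each summand the vector \<open>v i\<close> occurs at the single position
  \<open>inv \<sigma> i\<close>, which belongs to \<open>\<omega>\<close> or to
  \<open>\<theta>\<close>; this gives linearity. Composing \<open>\<sigma>\<close> with the
  transposition of two equal arguments changes only the sign, so the sum equals its own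
  negative.\<close>

lemma alternating_form_wedge:
  fixes \<omega> \<theta> :: "('m, 'e::euclidean_space) form"
  assumes \<omega>: "alternating_form k (\<omega> c x)" and \<theta>: "alternating_form l (\<theta> c x)"
  shows "alternating_form (k + l) (wedge k l \<omega> \<theta> c x)"
  unfolding alternating_form_def
proof (intro conjI allI impI; (elim conjE)?)
  let ?P = "{\<sigma>. \<sigma> permutes {..<k + l}}"
  let ?t = "\<lambda>v \<sigma>. of_int (sign \<sigma>) * \<omega> c x (\<lambda>i. v (\<sigma> i)) * \<theta> c x (\<lambda>i. v (\<sigma> (k + i))) :: real"
  have P: "\<sigma> i < k + l \<longleftrightarrow> i < k + l" if "\<sigma> \<in> ?P" for \<sigma> i
    using that permutes_in_image[of \<sigma> "{..<k + l}" i] by simp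
  fix v :: "nat \<Rightarrow> 'e"
  show "wedge k l \<omega> \<theta> c x v = wedge k l \<omega> \<theta> c x w" if eq: "\<forall>i<k + l. v i = w i" for w
  proof -
    have "?t v \<sigma> = ?t w \<sigma>" if "\<sigma> \<in> ?P" for \<sigma>
      using eq P[OF that] alternating_form_local[OF \<omega>, of "\<lambda>i. v (\<sigma> i)" "\<lambda>i. w (\<sigma> i)"]
        alternating_form_local[OF \<theta>, of "\<lambda>i. v (\<sigma> (k + i))" "\<lambda>i. w (\<sigma> (k + i))"] by simp
    then show ?thesis unfolding wedge_def by (metis (mono_tags, lifting) sum.cong)
  qed
  show "linear (\<lambda>u. wedge k l \<omega> \<theta> c x (v(i := u)))" if i: "i < k + l" for i
  proof -
    have "linear (\<lambda>u. ?t (v(i := u)) \<sigma>)" if \<sigma>: "\<sigma> \<in> ?P" for \<sigma>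
    proof -
      define j where "j = inv \<sigma> i"
      have inj: "inj \<sigma>" using \<sigma> permutes_inj by auto
      have j: "\<sigma> j = i" using \<sigma> permutes_inverses(1) by (auto simp: j_def)
      have upd: "(v(i := u)) (\<sigma> m) = ((\<lambda>m. v (\<sigma> m))(j := u)) m" for u m
        using inj j by (auto simp: inj_def)
      have jb: "j < k + l" using P[OF \<sigma>, of j] i j by simp
      show ?thesis
      proof (cases "j < k")
        case True
        then have 1: "(\<lambda>m. ((\<lambda>m. v (\<sigma> m))(j := u)) (k + m)) = (\<lambda>m. v (\<sigma> (k + m)))" for u
          by auto
        have "(\<lambda>u. ?t (v(i := u)) \<sigma>) =
            (\<lambda>u. (of_int (sign \<sigma>) * \<theta> c x (\<lambda>m. v (\<sigma> (k + m)))) *\<^sub>R \<omega> c x ((\<lambda>m. v (\<sigma> m))(j := u)))"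
          unfolding upd 1 real_scaleR_def by (simp only: mult_ac)
        then show ?thesis
          using linear_compose_scale_right[OF alternating_form_linear[OF \<omega> True]] by metis
      next
        case False
        then obtain j' where j': "j = k + j'" "j' < l" using jb by (metis add_less_cancel_left le_Suc_ex not_le)
        have 1: "(\<lambda>m. ((\<lambda>m. v (\<sigma> m))(j := u)) (k + m)) = (\<lambda>m. v (\<sigma> (k + m)))(j' := u)" for u
          using j' by auto
        have 2: "\<omega> c x (\<lambda>m. ((\<lambda>m. v (\<sigma> m))(j := u)) m) = \<omega> c x (\<lambda>m. v (\<sigma> m))" for u
          using j' by (intro alternating_form_local[OF \<omega>]) auto
        have "(\<lambda>u. ?t (v(i := u)) \<sigma>) =
            (\<lambda>u. (of_int (sign \<sigma>) * \<omega> c x (\<lambda>m. v (\<sigma> m))) *\<^sub>R \<theta> c x ((\<lambda>m. v (\<sigma> (k + m)))(j' := u)))"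
          unfolding upd 1 2 real_scaleR_def ..
        then show ?thesis
          using linear_compose_scale_right[OF alternating_form_linear[OF \<theta> j'(2)]] by metis
      qed
    qed
    then have "linear (\<lambda>u. \<Sum>\<sigma>\<in>?P. ?t (v(i := u)) \<sigma>)" by (rule linear_compose_sum[rule_format])
    from linear_compose_scale_right[OF this, of "1 / (fact k * fact l)"] show ?thesis
      by (simp add: wedge_def)
  qed
  show "wedge k l \<omega> \<theta> c x v = 0" if ij: "i < k + l" "j < k + l" "i \<noteq> j" "v i = v j" for i j
  proof -
    let ?\<tau> = "Transposition.transpose i j"
    have \<tau>: "?\<tau> permutes {..<k + l}" using ij by (intro permutes_swap_id) auto
    have v\<tau>: "v (?\<tau> m) = v m" for m using ij by (simp add: Transposition.transpose_def)
    have "(\<Sum>\<sigma>\<in>?P. ?t v \<sigma>) = (\<Sum>\<sigma>\<in>?P. ?t v (?\<tau> \<circ> \<sigma>))"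
      by (rule setum_permutations_compose_left[OF \<tau>])
    also have "\<dots> = (\<Sum>\<sigma>\<in>?P. - ?t v \<sigma>)"
    proof (rule sum.cong)
      fix \<sigma> assume "\<sigma> \<in> ?P"
      then have "sign (?\<tau> \<circ> \<sigma>) = - sign \<sigma>"
        using ij by (subst sign_compose) (auto simp: sign_swap_id permutation_swap_id intro: permutes_imp_permutation[rotated])
      then show "?t v (?\<tau> \<circ> \<sigma>) = - ?t v \<sigma>" by (simp add: v\<tau>)
    qed simp
    finally have "(\<Sum>\<sigma>\<in>?P. ?t v \<sigma>) = 0" by (simp add: sum_negf)
    then show ?thesis by (simp add: wedge_def)
  qed
qed

section \<open>Exterior and Lie derivatives in a chart\<close>

text \<open>The part of \<open>diff_form\<close> that concerns one chart, without compatibility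
  under transitions. It lets the calculus run inside a single coordinate domain.\<close>

definition smooth_form_on ::
    "'e::euclidean_space set \<Rightarrow> nat \<Rightarrow> ('e \<Rightarrow> (nat \<Rightarrow> 'e) \<Rightarrow> real) \<Rightarrow> bool" where
  "smooth_form_on S k \<alpha> \<longleftrightarrow>
     (\<forall>x\<in>S. alternating_form k (\<alpha> x)) \<and> (\<forall>v. smooth_on (\<lambda>x. \<alpha> x v) S)"

lemma smooth_form_on_wedge:
  assumes "open S" "smooth_form_on S k (\<omega> c)" "smooth_form_on S l (\<theta> c)"
  shows "smooth_form_on S (k + l) (wedge k l \<omega> \<theta> c)"
proof -
  have "smooth_on (\<lambda>x. wedge k l \<omega> \<theta> c x v) S" for v
    unfolding wedge_def divide_inverse
    by (intro smooth_on_mult smooth_on_sum smooth_on_const assms(1))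
      (use assms(2,3) in \<open>simp_all add: smooth_form_on_def\<close>)
  then show ?thesis
    using assms(2,3) by (simp add: smooth_form_on_def alternating_form_wedge)
qed

lemma smooth_form_on_wedge_power:
  assumes "open S" "smooth_form_on S k (\<omega> c)"
  shows "smooth_form_on S (m * k) (wedge_power k \<omega> m c)"
proof (induction m)
  case 0
  then show ?case by (simp add: smooth_form_on_def of_fun_def alternating_form_def)
next
  case (Suc m)
  then show ?case using smooth_form_on_wedge[where \<omega>=\<omega> and c=c, OF assms] by simp
qed

text \<open>The constant sequence \<open>\<lambda>_. u\<close> serves from here on as normal form
  for the argument of a one-form, which turns the form into a functional of the single vector
  \<open>u\<close>.\<close>

lemma one_form_first:
  "smooth_form_on S 1 \<alpha> \<Longrightarrow> x \<in> S \<Longrightarrow> \<alpha> x v = \<alpha> x (\<lambda>_. v 0)"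
  by (rule alternating_form_local[where k=1]) (auto simp: smooth_form_on_def)

lemma one_form_linear:
  assumes "smooth_form_on S 1 \<alpha>" "x \<in> S"
  shows "linear (\<lambda>u. \<alpha> x (\<lambda>_. u))"
proof -
  have "linear (\<lambda>u. \<alpha> x ((\<lambda>_. 0)(0 := u)))"
    using assms by (intro alternating_form_linear[where k=1]) (auto simp: smooth_form_on_def)
  then show ?thesis by (simp add: one_form_first[OF assms, of "_(0 := _)"])
qed

lemma ext_d_one_form:
  assumes "open S" "smooth_form_on S 1 (\<omega> c)" "x \<in> S"
  shows "ext_d 1 \<omega> c x v =
    frechet_derivative (\<lambda>y. \<omega> c y (\<lambda>_. v 1)) (at x) (v 0) -
    frechet_derivative (\<lambda>y. \<omega> c y (\<lambda>_. v 0)) (at x) (v 1)"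
proof -
  have "frechet_derivative (\<lambda>y. \<omega> c y w) (at x) = frechet_derivative (\<lambda>y. \<omega> c y (\<lambda>_. w 0)) (at x)" for w
    using one_form_first[OF assms(2)] by (intro frechet_derivative_cong_open[OF assms(1,3)])
  from this[of "\<lambda>j. v (Suc j)"] this[of "\<lambda>j. v (if j < 1 then j else Suc j)"]
  show ?thesis by (simp add: ext_d_def)
qed

lemma alternating_two_formI:
  fixes \<alpha> :: "(nat \<Rightarrow> 'e::real_vector) \<Rightarrow> real"
  assumes eq: "\<And>v. \<alpha> v = B (v 0) (v 1) - B (v 1) (v 0)"
    and lin: "\<And>u. linear (B u)" "\<And>u. linear (\<lambda>w. B w u)"
  shows "alternating_form 2 \<alpha>"
  unfolding alternating_form_def eq
proof (intro conjI allI impI)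
  fix v :: "nat \<Rightarrow> 'e" and i :: nat
  assume "i < 2"
  then consider "i = 0" | "i = 1" by linarith
  then show "linear (\<lambda>u. B ((v(i := u)) 0) ((v(i := u)) 1) - B ((v(i := u)) 1) ((v(i := u)) 0))"
    using lin by cases (auto intro: linear_compose_sub)
next
  fix v :: "nat \<Rightarrow> 'e" and i j :: nat
  assume "i < 2" "j < 2" "i \<noteq> j \<and> v i = v j"
  then have "v 0 = v 1" by (metis less_2_cases One_nat_def)
  then show "B (v 0) (v 1) - B (v 1) (v 0) = 0" by simp
qed auto

lemma linear_frechet_derivative_parameter:
  fixes f :: "'a::euclidean_space \<Rightarrow> 'b::real_vector \<Rightarrow> real"
  assumes S: "open S" "x \<in> S" and f: "\<And>y. y \<in> S \<Longrightarrow> linear (f y)" "\<And>u. smooth_on (\<lambda>y. f y u) S"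
  shows "linear (\<lambda>u. frechet_derivative (\<lambda>y. f y u) (at x) z)"
proof (rule linearI)
  note d = smooth_on_imp_differentiable[OF S(1) f(2) S(2)]
  show "frechet_derivative (\<lambda>y. f y (u + w)) (at x) z =
      frechet_derivative (\<lambda>y. f y u) (at x) z + frechet_derivative (\<lambda>y. f y w) (at x) z" for u w
    using frechet_derivative_cong_open[OF S, of "\<lambda>y. f y (u + w)" "\<lambda>y. f y u + f y w"]
    by (simp add: linear_add[OF f(1)] frechet_derivative_add d)
  show "frechet_derivative (\<lambda>y. f y (r *\<^sub>R u)) (at x) z =
      r *\<^sub>R frechet_derivative (\<lambda>y. f y u) (at x) z" for r u
    using frechet_derivative_cong_open[OF S, of "\<lambda>y. f y (r *\<^sub>R u)" "\<lambda>y. r * f y u"]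
    by (simp add: linear_scale[OF f(1)] frechet_derivative_mult d)
qed

lemma smooth_form_on_ext_d:
  fixes \<omega> :: "('m, 'e::euclidean_space) form"
  assumes S: "open S" and \<omega>: "smooth_form_on S 1 (\<omega> c)"
  shows "smooth_form_on S 2 (ext_d 1 \<omega> c)"
  unfolding smooth_form_on_def
proof (intro conjI ballI allI)
  note sm = \<omega>[unfolded smooth_form_on_def, THEN conjunct2, rule_format]
  fix x assume x: "x \<in> S"
  show "alternating_form 2 (ext_d 1 \<omega> c x)"
  proof (rule alternating_two_formI)
    show "ext_d 1 \<omega> c x v = frechet_derivative (\<lambda>y. \<omega> c y (\<lambda>_. v 1)) (at x) (v 0) -
        frechet_derivative (\<lambda>y. \<omega> c y (\<lambda>_. v 0)) (at x) (v 1)" for v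
      by (rule ext_d_one_form[where \<omega>=\<omega> and c=c, OF S \<omega> x])
    show "linear (\<lambda>u. frechet_derivative (\<lambda>y. \<omega> c y (\<lambda>_. u)) (at x) w)" for w
      by (rule linear_frechet_derivative_parameter[OF S x]) (auto intro: one_form_linear[OF \<omega>] sm)
    show "linear (\<lambda>u. frechet_derivative (\<lambda>y. \<omega> c y (\<lambda>_. w)) (at x) u)" for w
      using smooth_on_imp_differentiable[OF S sm x] by (rule linear_frechet_derivative)
  qed
next
  note sm = \<omega>[unfolded smooth_form_on_def, THEN conjunct2, rule_format]
  fix v :: "nat \<Rightarrow> 'e"
  have "smooth_on (\<lambda>x. frechet_derivative (\<lambda>y. \<omega> c y (\<lambda>_. v 1)) (at x) (v 0) -
      frechet_derivative (\<lambda>y. \<omega> c y (\<lambda>_. v 0)) (at x) (v 1)) S"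
    by (intro smooth_on_diff S smooth_on_frechet_derivative sm)
  then show "smooth_on (\<lambda>x. ext_d 1 \<omega> c x v) S"
    by (subst smooth_on_cong[OF S ext_d_one_form[where \<omega>=\<omega> and c=c, OF S \<omega>]])
qed

lemma sum_lessThan_add:
  fixes f :: "nat \<Rightarrow> 'a::comm_monoid_add"
  shows "(\<Sum>i<k + l. f i) = (\<Sum>i<k. f i) + (\<Sum>i<l. f (k + i))"
  by (induction l) (simp_all add: add.assoc)

text \<open>The Leibniz rule, without signs because the Lie derivative preserves degrees. The
  directional derivative obeys the product rule in each summand; for the insertions of
  \<open>DX\<close> the slots are sorted by the factor that they feed.\<close>

lemma lie_deriv_wedge:
  fixes \<omega> \<theta> :: "('m, 'e::euclidean_space) form"
  assumes \<omega>: "alternating_form k (\<omega> c x)" "\<And>v. (\<lambda>y. \<omega> c y v) differentiable at x"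
    and \<theta>: "alternating_form l (\<theta> c x)" "\<And>v. (\<lambda>y. \<theta> c y v) differentiable at x"
  shows "lie_deriv (k + l) X (wedge k l \<omega> \<theta>) c x v =
    wedge k l (lie_deriv k X \<omega>) \<theta> c x v + wedge k l \<omega> (lie_deriv l X \<theta>) c x v"
proof -
  let ?P = "{\<sigma>. \<sigma> permutes {..<k + l}}"
  let ?A = "frechet_derivative (X c) (at x)"
  let ?Z = "X c x"
  let ?N = "inverse (fact k * fact l) :: real"
  define s where "s \<sigma> = real_of_int (sign \<sigma>)" for \<sigma> :: "nat \<Rightarrow> nat"
  define p where "p v \<sigma> = (\<lambda>i. v (\<sigma> i))" for v :: "nat \<Rightarrow> 'e" and \<sigma> :: "nat \<Rightarrow> nat"
  define q where "q v \<sigma> = (\<lambda>i. v (\<sigma> (k + i)))" for v :: "nat \<Rightarrow> 'e" and \<sigma> :: "nat \<Rightarrow> nat"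
  define D\<omega> where "D\<omega> v = frechet_derivative (\<lambda>y. \<omega> c y v) (at x)" for v
  define D\<theta> where "D\<theta> v = frechet_derivative (\<lambda>y. \<theta> c y v) (at x)" for v
  have d\<omega>: "((\<lambda>y. \<omega> c y v) has_derivative D\<omega> v) (at x)" for v
    using \<omega>(2) by (simp add: D\<omega>_def frechet_derivative_works)
  have d\<theta>: "((\<lambda>y. \<theta> c y v) has_derivative D\<theta> v) (at x)" for v
    using \<theta>(2) by (simp add: D\<theta>_def frechet_derivative_works)
  have wedge: "wedge k l \<omega> \<theta> c y v = (\<Sum>\<sigma>\<in>?P. s \<sigma> * \<omega> c y (p v \<sigma>) * \<theta> c y (q v \<sigma>)) * ?N"
    for \<omega> \<theta> :: "('m, 'e) form" and y v
    by (simp add: wedge_def s_def p_def q_def divide_inverse)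
  have "((\<lambda>y. wedge k l \<omega> \<theta> c y v) has_derivative
      (\<lambda>h. (\<Sum>\<sigma>\<in>?P. (s \<sigma> * \<omega> c x (p v \<sigma>)) * D\<theta> (q v \<sigma>) h + (s \<sigma> * D\<omega> (p v \<sigma>) h) * \<theta> c x (q v \<sigma>)) * ?N))
      (at x)"
    unfolding wedge
    by (intro has_derivative_mult_left has_derivative_sum has_derivative_mult has_derivative_mult_right
        d\<omega> d\<theta>)
  then have D: "frechet_derivative (\<lambda>y. wedge k l \<omega> \<theta> c y v) (at x) ?Z =
      (\<Sum>\<sigma>\<in>?P. s \<sigma> * D\<omega> (p v \<sigma>) ?Z * \<theta> c x (q v \<sigma>)) * ?N +
      (\<Sum>\<sigma>\<in>?P. s \<sigma> * \<omega> c x (p v \<sigma>) * D\<theta> (q v \<sigma>) ?Z) * ?N"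
    by (simp add: frechet_derivative_at[symmetric] sum.distrib algebra_simps)
  have slots: "(\<Sum>i<k + l. \<omega> c x (p (v(i := ?A (v i))) \<sigma>) * \<theta> c x (q (v(i := ?A (v i))) \<sigma>)) =
      (\<Sum>i<k. \<omega> c x ((p v \<sigma>)(i := ?A (p v \<sigma> i)))) * \<theta> c x (q v \<sigma>) +
      \<omega> c x (p v \<sigma>) * (\<Sum>i<l. \<theta> c x ((q v \<sigma>)(i := ?A (q v \<sigma> i))))" if "\<sigma> \<in> ?P" for \<sigma>
  proof -
    have \<sigma>: "\<sigma> permutes {..<k + l}" and inj: "inj \<sigma>" using that permutes_inj by auto
    have 1: "p (v(\<sigma> i := a)) \<sigma> = (p v \<sigma>)(i := a)" for i a
      by (auto simp: p_def fun_eq_iff inj_eq[OF inj])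
    have 2: "q (v(\<sigma> i := a)) \<sigma> = q v \<sigma>" if "i < k" for i a
      using that by (auto simp: q_def fun_eq_iff inj_eq[OF inj])
    have 3: "\<omega> c x (p (v(\<sigma> (k + i) := a)) \<sigma>) = \<omega> c x (p v \<sigma>)" for i a
      unfolding 1 by (rule alternating_form_local[OF \<omega>(1)]) simp
    have 4: "q (v(\<sigma> (k + i) := a)) \<sigma> = (q v \<sigma>)(i := a)" for i a
      by (auto simp: q_def fun_eq_iff inj_eq[OF inj])
    \<comment> \<open>Reindexing the slots by \<open>\<sigma>\<close> puts those that feed
      \<open>\<omega>\<close> first and those that feed \<open>\<theta>\<close> last.\<close>
    have "(\<Sum>i<k + l. \<omega> c x (p (v(i := ?A (v i))) \<sigma>) * \<theta> c x (q (v(i := ?A (v i))) \<sigma>)) =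
        (\<Sum>i<k + l. \<omega> c x (p (v(\<sigma> i := ?A (v (\<sigma> i)))) \<sigma>) * \<theta> c x (q (v(\<sigma> i := ?A (v (\<sigma> i)))) \<sigma>))"
      by (subst sum.permute[OF \<sigma>]) (simp add: comp_def)
    also have "\<dots> = (\<Sum>i<k. \<omega> c x ((p v \<sigma>)(i := ?A (v (\<sigma> i)))) * \<theta> c x (q v \<sigma>)) +
        (\<Sum>i<l. \<omega> c x (p v \<sigma>) * \<theta> c x ((q v \<sigma>)(i := ?A (v (\<sigma> (k + i))))))"
      unfolding sum_lessThan_add by (simp add: 2 3 4 del: fun_upd_apply) (simp add: 1)
    also have "\<dots> = (\<Sum>i<k. \<omega> c x ((p v \<sigma>)(i := ?A (p v \<sigma> i)))) * \<theta> c x (q v \<sigma>) +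
        \<omega> c x (p v \<sigma>) * (\<Sum>i<l. \<theta> c x ((q v \<sigma>)(i := ?A (q v \<sigma> i))))"
      by (simp add: sum_distrib_left sum_distrib_right p_def q_def)
    finally show ?thesis .
  qed
  have "(\<Sum>i<k + l. wedge k l \<omega> \<theta> c x (v(i := ?A (v i)))) =
      (\<Sum>\<sigma>\<in>?P. s \<sigma> * (\<Sum>i<k + l. \<omega> c x (p (v(i := ?A (v i))) \<sigma>) * \<theta> c x (q (v(i := ?A (v i))) \<sigma>))) * ?N"
    unfolding wedge sum_distrib_left sum_distrib_right by (subst sum.swap) (simp add: mult.assoc)
  also have "\<dots> = (\<Sum>\<sigma>\<in>?P. s \<sigma> * (\<Sum>i<k. \<omega> c x ((p v \<sigma>)(i := ?A (p v \<sigma> i)))) * \<theta> c x (q v \<sigma>)) * ?N +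
      (\<Sum>\<sigma>\<in>?P. s \<sigma> * \<omega> c x (p v \<sigma>) * (\<Sum>i<l. \<theta> c x ((q v \<sigma>)(i := ?A (q v \<sigma> i))))) * ?N"
    by (simp add: slots distrib_left sum.distrib distrib_right mult.assoc)
  finally show ?thesis
    unfolding lie_deriv_def[of "k + l"] D
    by (simp add: wedge lie_deriv_def D\<omega>_def D\<theta>_def distrib_left distrib_right sum.distrib)
qed

text \<open>Makes the kernel criterion \<open>wedge_eq_0_if_kernel\<close> applicable to a right
  factor built from a Lie derivative.\<close>

lemma alternating_form_lie_deriv:
  fixes X :: "('m, 'e::euclidean_space) vfield"
  assumes S: "open S" "x \<in> S" and \<omega>: "smooth_form_on S k (\<omega> c)" and X: "X c differentiable at x"
  shows "alternating_form k (lie_deriv k X \<omega> c x)"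
  unfolding alternating_form_def
proof (intro conjI allI impI; (elim conjE)?)
  let ?A = "frechet_derivative (X c) (at x)"
  let ?Z = "X c x"
  have alt: "\<And>y. y \<in> S \<Longrightarrow> alternating_form k (\<omega> c y)" and sm: "\<And>v. smooth_on (\<lambda>y. \<omega> c y v) S"
    using \<omega> by (auto simp: smooth_form_on_def)
  have linA: "linear ?A" using X by (rule linear_frechet_derivative)
  fix v :: "nat \<Rightarrow> 'e"
  show "lie_deriv k X \<omega> c x v = lie_deriv k X \<omega> c x w" if eq: "\<forall>i<k. v i = w i" for w
  proof -
    have "frechet_derivative (\<lambda>y. \<omega> c y v) (at x) = frechet_derivative (\<lambda>y. \<omega> c y w) (at x)"
      using eq by (intro frechet_derivative_cong_open[OF S] alternating_form_local[OF alt]) auto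
    moreover have "\<omega> c x (v(i := ?A (v i))) = \<omega> c x (w(i := ?A (w i)))" if "i < k" for i
      using eq that by (intro alternating_form_local[OF alt[OF S(2)]]) auto
    ultimately show ?thesis by (simp add: lie_deriv_def)
  qed
  show "linear (\<lambda>u. lie_deriv k X \<omega> c x (v(i := u)))" if i: "i < k" for i
  proof -
    have "linear (\<lambda>u. frechet_derivative (\<lambda>y. \<omega> c y (v(i := u))) (at x) ?Z)"
      by (rule linear_frechet_derivative_parameter[OF S]) (auto intro: alternating_form_linear[OF alt i] sm)
    moreover have "linear (\<lambda>u. \<omega> c x ((v(i := u))(j := ?A ((v(i := u)) j))))" if "j < k" for j
    proof (cases "j = i")
      case True
      then show ?thesis
        using linear_compose[OF linA alternating_form_linear[OF alt[OF S(2)] i, of v]] by (simp add: comp_def)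
    next
      case False
      then show ?thesis
        using alternating_form_linear[OF alt[OF S(2)] i, of "v(j := ?A (v j))"]
        by (simp add: fun_upd_twist)
    qed
    ultimately show ?thesis
      unfolding lie_deriv_def by (intro linear_compose_add linear_compose_sum) auto
  qed
  show "lie_deriv k X \<omega> c x v = 0" if ij: "i < k" "j < k" "i \<noteq> j" "v i = v j" for i j
  proof -
    have "frechet_derivative (\<lambda>y. \<omega> c y v) (at x) = frechet_derivative (\<lambda>y. 0) (at x)"
      using ij by (intro frechet_derivative_cong_open[OF S] alternating_form_zero[OF alt])
    \<comment> \<open>Changing a slot other than \<open>i\<close> and \<open>j\<close> keeps two
      equal arguments, so only these two summands survive; they cancel by antisymmetry.\<close>
    moreover have "(\<Sum>m<k. \<omega> c x (v(m := ?A (v m)))) = (\<Sum>m\<in>{i, j}. \<omega> c x (v(m := ?A (v m))))"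
      using ij by (intro sum.mono_neutral_right) (auto intro!: alternating_form_zero[OF alt[OF S(2)], of i j])
    moreover have "\<omega> c x (v(i := ?A (v i))) = - \<omega> c x (v(j := ?A (v j)))"
    proof -
      have "v(i := ?A (v i)) = v(i := ?A (v i), j := v j)" "v(j := ?A (v j)) = v(i := v j, j := ?A (v i))"
        using ij by (auto simp: fun_eq_iff)
      then show ?thesis
        using alternating_form_swap[OF alt[OF S(2)] ij(1-3), of v "?A (v i)" "v j"] by simp
    qed
    ultimately show ?thesis
      using ij by (simp add: lie_deriv_def)
  qed
qed

text \<open>The equation for the Lie derivative of \<open>\<omega>\<close>, taken at a constant
  vector \<open>u\<close>, is differentiated in a direction \<open>w\<close> and antisymmetrised in
  \<open>u\<close> and \<open>w\<close>. Second derivatives of \<open>X\<close> cancel, the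
  derivatives of \<open>f\<close> come multiplied by values of \<open>\<omega>\<close> on
  \<open>v 0\<close> and \<open>v 1\<close>, which are zero, and what remains is the claim. This
  replaces the commutation of Lie and exterior derivatives.\<close>

lemma lie_deriv_ext_d_on_kernel:
  fixes \<omega> :: "('m, 'e::euclidean_space) form"
  assumes S: "open S" "x \<in> S" and \<omega>: "smooth_form_on S 1 (\<omega> c)" and X: "smooth_on (X c) S"
    and L: "\<And>y v. y \<in> S \<Longrightarrow> lie_deriv 1 X \<omega> c y v = - f y * \<omega> c y v"
    and f: "f differentiable at x"
    and ker: "\<omega> c x (\<lambda>_. v 0) = 0" "\<omega> c x (\<lambda>_. v 1) = 0"
  shows "lie_deriv 2 X (ext_d 1 \<omega>) c x v = - f x * ext_d 1 \<omega> c x v"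
proof -
  define b where "b y u = \<omega> c y (\<lambda>_. u)" for y u
  define D where "D u y = frechet_derivative (\<lambda>y. b y u) (at y)" for u y
  define A where "A y = frechet_derivative (X c) (at y)" for y
  have bsm: "smooth_on (\<lambda>y. b y u) S" for u
    using \<omega> by (simp add: b_def smooth_form_on_def)
  have blin: "linear (b y)" if "y \<in> S" for y
    unfolding b_def by (rule one_form_linear[OF \<omega> that])
  have Dsm: "smooth_on (\<lambda>y. D u y z) S" for u z
    unfolding D_def by (rule smooth_on_frechet_derivative[OF bsm])
  have Dlin: "linear (D u y)" if "y \<in> S" for u y
    unfolding D_def using smooth_on_imp_differentiable[OF S(1) bsm that] by (rule linear_frechet_derivative)
  have Asm: "smooth_on (\<lambda>y. A y u) S" for u
    unfolding A_def by (rule smooth_on_frechet_derivative[OF X])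
  note d = smooth_on_imp_differentiable[OF S(1) _ S(2)]
  have Lu: "D u y (X c y) + b y (A y u) = - f y * b y u" if "y \<in> S" for y u
    using L[OF that, of "\<lambda>_. u"] one_form_first[OF \<omega> that, of "_(0 := _)"]
    by (simp add: lie_deriv_def D_def b_def A_def)
  \<comment> \<open>The identity \<open>Lu\<close> differentiated in direction \<open>w\<close> at
    \<open>x\<close>; the product rule separates the motion of \<open>X\<close> and of
    \<open>A\<close> from that of the form.\<close>
  have K: "frechet_derivative (\<lambda>y. D u y (X c x)) (at x) w + D u x (A x w) +
      D (A x u) x w + b x (frechet_derivative (\<lambda>y. A y u) (at x) w) =
      - (f x * D u x w + frechet_derivative f (at x) w * b x u)" for u w
  proof -
    have "frechet_derivative (\<lambda>y. D u y (X c y) + b y (A y u)) (at x) w =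
        frechet_derivative (\<lambda>y. D u y (X c y)) (at x) w + frechet_derivative (\<lambda>y. b y (A y u)) (at x) w"
      by (rule frechet_derivative_add[OF d[OF smooth_on_pairing[OF S(1) Dlin Dsm X]]
            d[OF smooth_on_pairing[OF S(1) blin bsm Asm]]])
    moreover have "frechet_derivative (\<lambda>y. D u y (X c y)) (at x) w =
        frechet_derivative (\<lambda>y. D u y (X c x)) (at x) w + D u x (A x w)"
      unfolding A_def by (rule frechet_derivative_pairing[OF S Dlin Dsm X])
    moreover have "frechet_derivative (\<lambda>y. b y (A y u)) (at x) w =
        D (A x u) x w + b x (frechet_derivative (\<lambda>y. A y u) (at x) w)"
      unfolding D_def by (rule frechet_derivative_pairing[OF S blin bsm Asm])
    moreover have "frechet_derivative (\<lambda>y. D u y (X c y) + b y (A y u)) (at x) w =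
        frechet_derivative (\<lambda>y. - 1 * (f y * b y u)) (at x) w"
      by (subst frechet_derivative_cong_open[OF S Lu]) simp_all
    moreover have "\<dots> = - (f x * D u x w + frechet_derivative f (at x) w * b x u)"
      using f d[OF bsm, of u] frechet_derivative_mult[of "\<lambda>_. -1" x "\<lambda>y. f y * b y u" w]
      by (simp add: D_def frechet_derivative_mult differentiable_mult)
    ultimately show ?thesis by simp
  qed
  have ext: "ext_d 1 \<omega> c y w = D (w 1) y (w 0) - D (w 0) y (w 1)" if "y \<in> S" for y w
    unfolding D_def b_def by (rule ext_d_one_form[where \<omega>=\<omega> and c=c, OF S(1) \<omega> that])
  have "frechet_derivative (\<lambda>y. ext_d 1 \<omega> c y v) (at x) =
      frechet_derivative (\<lambda>y. D (v 1) y (v 0) - D (v 0) y (v 1)) (at x)"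
    by (rule frechet_derivative_cong_open[OF S ext])
  then have "frechet_derivative (\<lambda>y. ext_d 1 \<omega> c y v) (at x) (X c x) =
      frechet_derivative (\<lambda>y. D (v 1) y (v 0)) (at x) (X c x) -
      frechet_derivative (\<lambda>y. D (v 0) y (v 1)) (at x) (X c x)"
    by (simp only: frechet_derivative_diff[OF d[OF Dsm] d[OF Dsm]])
  also have "\<dots> = frechet_derivative (\<lambda>y. D (v 1) y (X c x)) (at x) (v 0) -
      frechet_derivative (\<lambda>y. D (v 0) y (X c x)) (at x) (v 1)"
    unfolding D_def
    by (simp only: symmetric_second_derivative[OF S bsm, of _ _ "X c x"])
  finally have "lie_deriv 2 X (ext_d 1 \<omega>) c x v =
      frechet_derivative (\<lambda>y. D (v 1) y (X c x)) (at x) (v 0) -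
      frechet_derivative (\<lambda>y. D (v 0) y (X c x)) (at x) (v 1) +
      (D (v 1) x (A x (v 0)) - D (A x (v 0)) x (v 1) + (D (A x (v 1)) x (v 0) - D (v 0) x (A x (v 1))))"
    by (simp add: lie_deriv_def numeral_2_eq_2 ext[OF S(2), unfolded One_nat_def] A_def)
  moreover have "frechet_derivative (\<lambda>y. A y (v 1)) (at x) (v 0) = frechet_derivative (\<lambda>y. A y (v 0)) (at x) (v 1)"
    unfolding A_def by (rule symmetric_second_derivative[OF S X])
  ultimately show ?thesis
    using K[of "v 1" "v 0"] K[of "v 0" "v 1"] ker unfolding ext[OF S(2)] by (simp add: b_def algebra_simps)
qed

text \<open>The predicate \<open>P\<close> allows proportionality that holds only on kernel vectors:
  a wedge product evaluates its factors on permutations of the entries of \<open>v\<close>, so they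
  all satisfy \<open>P\<close>.\<close>

lemma wedge_scale_left:
  assumes "\<And>w. (\<And>i. P (w i)) \<Longrightarrow> \<omega> c x w = r * \<omega>' c x w" "\<And>i. P (v i)"
  shows "wedge k l \<omega> \<theta> c x v = r * wedge k l \<omega>' \<theta> c x v"
  using assms by (simp add: wedge_def sum_distrib_left mult_ac)

lemma wedge_scale_right:
  assumes "\<And>w. (\<And>i. P (w i)) \<Longrightarrow> \<theta> c x w = r * \<theta>' c x w" "\<And>i. P (v i)"
  shows "wedge k l \<omega> \<theta> c x v = r * wedge k l \<omega> \<theta>' c x v"
  using assms by (simp add: wedge_def sum_distrib_left mult_ac)

lemma wedge_add_scale_right:
  "wedge k l \<omega> (\<lambda>c x v. \<theta> c x v + r * \<theta>' c x v) c x v = wedge k l \<omega> \<theta> c x v + r * wedge k l \<omega> \<theta>' c x v"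
  unfolding wedge_def add_divide_distrib[symmetric] times_divide_eq_right sum_distrib_left sum.distrib[symmetric]
  by (intro arg_cong[where f="\<lambda>x. x / _"] sum.cong) (auto simp: algebra_simps)

text \<open>Each of the \<open>m\<close> factors contributes \<open>- r\<close>. Splitting by the
  Leibniz rule comes first, so Lie derivatives of \<open>W\<close> are only ever evaluated on
  entries of \<open>v\<close>, and \<open>DX\<close> may move vectors out of
  \<open>P\<close>.\<close>

lemma lie_deriv_wedge_power_on_kernel:
  fixes W :: "('m, 'e::euclidean_space) form"
  assumes S: "open S" "x \<in> S" and W: "smooth_form_on S 2 (W c)"
    and L: "\<And>v. (\<And>i. P (v i)) \<Longrightarrow> lie_deriv 2 X W c x v = - r * W c x v"
    and v: "\<And>i. P (v i)"
  shows "lie_deriv (m * 2) X (wedge_power 2 W m) c x v = - (of_nat m * r) * wedge_power 2 W m c x v"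
  using v
proof (induction m arbitrary: v)
  case 0
  then show ?case by (simp add: lie_deriv_def of_fun_def)
next
  case (Suc m)
  let ?Wm = "wedge_power 2 W m"
  have Wm: "smooth_form_on S (m * 2) (?Wm c)"
    by (rule smooth_form_on_wedge_power[where c=c and \<omega>=W, OF S(1) W])
  have "lie_deriv (2 + m * 2) X (wedge 2 (m * 2) W ?Wm) c x v =
      wedge 2 (m * 2) (lie_deriv 2 X W) ?Wm c x v + wedge 2 (m * 2) W (lie_deriv (m * 2) X ?Wm) c x v"
    using W Wm S(2)
    by (intro lie_deriv_wedge smooth_on_imp_differentiable[OF S(1) _ S(2)]) (auto simp: smooth_form_on_def)
  also have "wedge 2 (m * 2) (lie_deriv 2 X W) ?Wm c x v = - r * wedge 2 (m * 2) W ?Wm c x v"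
    by (rule wedge_scale_left[where P=P]) (use L Suc.prems in auto)
  also have "wedge 2 (m * 2) W (lie_deriv (m * 2) X ?Wm) c x v =
      - (of_nat m * r) * wedge 2 (m * 2) W ?Wm c x v"
    by (rule wedge_scale_right[where P=P]) (use Suc in auto)
  finally show ?case by (simp add: algebra_simps)
qed

lemma smooth_form_on_contact_volume:
  assumes S: "open S" and \<omega>: "smooth_form_on S 1 (\<omega> c)"
  shows "smooth_form_on S (1 + n * 2) (contact_volume n \<omega> c)"
  unfolding contact_volume_def
  by (intro smooth_form_on_wedge smooth_form_on_wedge_power smooth_form_on_ext_d S \<omega>)

text \<open>The Lie derivative of \<open>d\<omega>\<close> is \<open>- f d\<omega> - df \<and> \<omega>\<close>. The second summand vanishes on the kernel of
  \<open>\<omega>\<close> and hence does not contribute to \<open>\<omega> \<and> (d\<omega>)\<^sup>n\<close>.\<close>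

lemma lie_deriv_contact_volume:
  fixes \<omega> :: "('m, 'e::euclidean_space) form"
  assumes S: "open S" "x \<in> S" and \<omega>: "smooth_form_on S 1 (\<omega> c)" and X: "smooth_on (X c) S"
    and L: "\<And>y v. y \<in> S \<Longrightarrow> lie_deriv 1 X \<omega> c y v = - f y * \<omega> c y v"
    and f: "f differentiable at x"
  shows "lie_deriv (1 + n * 2) X (contact_volume n \<omega>) c x v =
    - (of_nat (n + 1) * f x) * contact_volume n \<omega> c x v"
proof -
  let ?W = "ext_d 1 \<omega>"
  let ?Wn = "wedge_power 2 ?W n"
  define P where "P u \<longleftrightarrow> \<omega> c x (\<lambda>_. u) = 0" for u
  \<comment> \<open>The defect of the expected scaling law for the Lie derivative of the wedge
    power. It vanishes on the kernel of \<open>\<omega>\<close>, hence after multiplication by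
    \<open>\<omega>\<close>.\<close>
  define \<theta> where "\<theta> = (\<lambda>c' y v. lie_deriv (n * 2) X ?Wn c' y v + (of_nat n * f x) * ?Wn c' y v)"
  have W: "smooth_form_on S 2 (?W c)" by (rule smooth_form_on_ext_d[where c=c and \<omega>=\<omega>, OF S(1) \<omega>])
  have Wn: "smooth_form_on S (n * 2) (?Wn c)"
    by (rule smooth_form_on_wedge_power[where c=c and \<omega>="?W", OF S(1) W])
  have LW: "lie_deriv 2 X ?W c x v = - f x * ?W c x v" if "\<And>i. P (v i)" for v
    using that by (intro lie_deriv_ext_d_on_kernel[OF S \<omega> X L f]) (auto simp: P_def)
  have "lie_deriv (n * 2) X ?Wn c x v = - (of_nat n * f x) * ?Wn c x v" if "\<And>i. P (v i)" for v
    by (rule lie_deriv_wedge_power_on_kernel[where c=c and W="?W" and P=P and r="f x", OF S W LW that])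
  then have "\<theta> c x v = 0" if "\<And>i. P (v i)" for v
    using that by (simp add: \<theta>_def)
  moreover have alt\<omega>: "alternating_form 1 (\<omega> c x)" and altW: "alternating_form (n * 2) (?Wn c x)"
    using \<omega> Wn S(2) by (auto simp: smooth_form_on_def)
  moreover have "alternating_form (n * 2) (\<theta> c x)"
    unfolding \<theta>_def
    using alternating_form_lie_deriv[where c=c and \<omega>="?Wn" and X=X, OF S Wn smooth_on_imp_differentiable[OF S(1) X S(2)]]
    by (intro alternating_form_add alternating_form_cmult altW)
  ultimately have "wedge 1 (n * 2) \<omega> \<theta> c x v = 0"
    by (intro wedge_eq_0_if_kernel alternating_form_wedge) (auto simp: P_def)
  then have "wedge 1 (n * 2) \<omega> (lie_deriv (n * 2) X ?Wn) c x v = - (of_nat n * f x) * contact_volume n \<omega> c x v"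
    unfolding \<theta>_def wedge_add_scale_right contact_volume_def by simp
  \<comment> \<open>The factor \<open>\<omega>\<close> scales on all vectors, not just on the
    kernel; it adds one to the \<open>n\<close> from the powers of \<open>d\<omega>\<close>.\<close>
  moreover have "wedge 1 (n * 2) (lie_deriv 1 X \<omega>) ?Wn c x v = - f x * contact_volume n \<omega> c x v"
    unfolding contact_volume_def by (rule wedge_scale_left[where P="\<lambda>_. True"]) (use L[OF S(2)] in auto)
  moreover have "lie_deriv (1 + n * 2) X (contact_volume n \<omega>) c x v =
      wedge 1 (n * 2) (lie_deriv 1 X \<omega>) ?Wn c x v + wedge 1 (n * 2) \<omega> (lie_deriv (n * 2) X ?Wn) c x v"
    unfolding contact_volume_def using \<omega> Wn S(2)
    by (intro lie_deriv_wedge smooth_on_imp_differentiable[OF S(1) _ S(2)]) (auto simp: smooth_form_on_def)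
  ultimately show ?thesis by (simp add: algebra_simps)
qed

section \<open>Charts and polynomial families\<close>

text \<open>Polynomials in \<open>t\<close> of degree at most \<open>m\<close> whose coefficients
  are smooth in \<open>x\<close>; this is the source of the smoothness of the
  \<open>C\<^sub>j\<close>. Coefficients above \<open>m\<close> are set to zero at every
  \<open>x\<close>, which suits Cauchy products.\<close>

definition poly_family_on :: "'e::euclidean_space set \<Rightarrow> nat \<Rightarrow> (real \<Rightarrow> 'e \<Rightarrow> real) \<Rightarrow> bool" where
  "poly_family_on S m F \<longleftrightarrow> (\<exists>K. (\<forall>j. smooth_on (K j) S) \<and> (\<forall>j>m. \<forall>x. K j x = 0) \<and>
     (\<forall>t. \<forall>x\<in>S. F t x = (\<Sum>j\<le>m. K j x * t ^ j)))"

lemma poly_family_on_const: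
  "smooth_on f S \<Longrightarrow> poly_family_on S 0 (\<lambda>t x. f x)"
  unfolding poly_family_on_def
  by (rule exI[of _ "\<lambda>j. if j = 0 then f else (\<lambda>_. 0)"]) simp

lemma poly_family_on_affine:
  "smooth_on f S \<Longrightarrow> smooth_on g S \<Longrightarrow> poly_family_on S 1 (\<lambda>t x. f x + t * g x)"
  unfolding poly_family_on_def
  by (rule exI[of _ "\<lambda>j. if j = 0 then f else if j = 1 then g else (\<lambda>_. 0)"]) (simp add: mult.commute)

lemma poly_family_on_mult:
  assumes S: "open S" and "poly_family_on S m F" "poly_family_on S m' G"
  shows "poly_family_on S (m + m') (\<lambda>t x. F t x * G t x)"
proof -
  obtain K where K: "\<And>j. smooth_on (K j) S" "\<And>j x. j > m \<Longrightarrow> K j x = 0"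
      "\<And>t x. x \<in> S \<Longrightarrow> F t x = (\<Sum>j\<le>m. K j x * t ^ j)"
    using assms(2) unfolding poly_family_on_def by blast
  obtain L where L: "\<And>j. smooth_on (L j) S" "\<And>j x. j > m' \<Longrightarrow> L j x = 0"
      "\<And>t x. x \<in> S \<Longrightarrow> G t x = (\<Sum>j\<le>m'. L j x * t ^ j)"
    using assms(3) unfolding poly_family_on_def by blast
  \<comment> \<open>For \<open>j > m + m'\<close> every \<open>k\<close> has \<open>k > m\<close> or
    \<open>j - k > m'\<close>.\<close>
  have "(\<Sum>k\<le>j. K k x * L (j - k) x) = 0" if "j > m + m'" for j x
  proof (rule sum.neutral, rule ballI)
    show "K k x * L (j - k) x = 0" for k
      using K(2)[of k x] L(2)[of "j - k" x] that by (cases "k > m") auto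
  qed
  moreover have "F t x * G t x = (\<Sum>j\<le>m + m'. (\<Sum>k\<le>j. K k x * L (j - k) x) * t ^ j)" if "x \<in> S" for t x
    unfolding K(3)[OF that] L(3)[OF that] by (rule polynomial_product) (use K(2) L(2) in auto)
  ultimately show ?thesis
    unfolding poly_family_on_def
    by (intro exI[of _ "\<lambda>j x. \<Sum>k\<le>j. K k x * L (j - k) x"])
      (auto intro!: smooth_on_sum[OF S] smooth_on_mult[OF S] K(1) L(1))
qed

lemma poly_family_on_cmult:
  assumes S: "open S" and "poly_family_on S m F"
  shows "poly_family_on S m (\<lambda>t x. r * F t x)"
  using poly_family_on_mult[OF S poly_family_on_const[OF smooth_on_const[of r S]] assms(2)] by simp

lemma poly_family_on_sum:
  assumes S: "open S" and F: "\<And>i. i \<in> I \<Longrightarrow> poly_family_on S m (F i)"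
  shows "poly_family_on S m (\<lambda>t x. \<Sum>i\<in>I. F i t x)"
proof -
  have "\<forall>i\<in>I. \<exists>K. (\<forall>j. smooth_on (K j) S) \<and> (\<forall>j>m. \<forall>x. K j x = 0) \<and>
      (\<forall>t. \<forall>x\<in>S. F i t x = (\<Sum>j\<le>m. K j x * t ^ j))"
    using F unfolding poly_family_on_def by blast
  from bchoice[OF this] obtain K where K: "\<And>i j. i \<in> I \<Longrightarrow> smooth_on (K i j) S"
      "\<And>i j x. i \<in> I \<Longrightarrow> j > m \<Longrightarrow> K i j x = 0"
      "\<And>i t x. i \<in> I \<Longrightarrow> x \<in> S \<Longrightarrow> F i t x = (\<Sum>j\<le>m. K i j x * t ^ j)"
    by blast
  have "(\<Sum>i\<in>I. F i t x) = (\<Sum>j\<le>m. (\<Sum>i\<in>I. K i j x) * t ^ j)" if "x \<in> S" for t x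
    unfolding sum_distrib_right by (subst sum.swap) (simp add: K(3) that)
  then show ?thesis
    unfolding poly_family_on_def
    by (intro exI[of _ "\<lambda>j x. \<Sum>i\<in>I. K i j x"]) (auto intro!: smooth_on_sum[OF S] K(1) simp: K(2))
qed

lemma poly_family_on_wedge:
  assumes S: "open S" and \<omega>: "\<And>v. poly_family_on S m (\<lambda>t x. \<omega> t c x v)"
    and \<theta>: "\<And>v. poly_family_on S m' (\<lambda>t x. \<theta> t c x v)"
  shows "poly_family_on S (m + m') (\<lambda>t x. wedge k l (\<omega> t) (\<theta> t) c x v)"
proof -
  have "poly_family_on S (m + m') (\<lambda>t x. inverse (fact k * fact l) * (\<Sum>\<sigma> | \<sigma> permutes {..<k + l}.
      of_int (sign \<sigma>) * (\<omega> t c x (\<lambda>i. v (\<sigma> i)) * \<theta> t c x (\<lambda>i. v (\<sigma> (k + i))))))"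
    by (intro poly_family_on_cmult[OF S] poly_family_on_sum[OF S] poly_family_on_mult[OF S] \<omega> \<theta>)
  then show ?thesis
    by (simp add: wedge_def divide_inverse mult_ac)
qed

lemma poly_family_on_wedge_power:
  assumes S: "open S" and \<omega>: "\<And>v. poly_family_on S 1 (\<lambda>t x. \<omega> t c x v)"
  shows "poly_family_on S n (\<lambda>t x. wedge_power k (\<omega> t) n c x v)"
proof (induction n arbitrary: v)
  case 0
  then show ?case using poly_family_on_const[OF smooth_on_const[of 1 S]] by (simp add: of_fun_def)
next
  case (Suc n)
  then show ?case
    using poly_family_on_wedge[where \<omega>=\<omega> and c=c and \<theta>="\<lambda>t. wedge_power k (\<omega> t) n", OF S \<omega>] by simp
qed

section \<open>Charts, overlaps and pullback along transition maps\<close>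

lemma chart_inv_in_dom: "x \<in> chart_target c \<Longrightarrow> chart_inv c x \<in> chart_dom c"
  unfolding chart_inv_def chart_target_def by (rule inv_into_into)

lemma is_chart_topspace: "is_chart M c \<Longrightarrow> topspace (subtopology M (chart_dom c)) = chart_dom c"
  unfolding is_chart_def by (auto dest: openin_subset)

lemma is_chart_open_target: "is_chart M c \<Longrightarrow> open (chart_target c)"
  by (simp add: is_chart_def)

lemma chart_inv_coords: "is_chart M c \<Longrightarrow> p \<in> chart_dom c \<Longrightarrow> chart_inv c (coords c p) = p"
  using homeomorphic_imp_injective_map is_chart_topspace unfolding is_chart_def chart_inv_def
  by (metis inv_into_f_f)

lemma coords_in_target: "p \<in> chart_dom c \<Longrightarrow> coords c p \<in> chart_target c"
  by (simp add: chart_target_def)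

lemma overlap_subset_target: "overlap c d \<subseteq> chart_target c"
  by (auto simp: overlap_def chart_target_def)

text \<open>The coordinate map is open onto the chart target, and relatively open subsets of an open
  target are open.\<close>

lemma open_overlap:
  assumes "is_chart M c" "is_chart M d"
  shows "open (overlap c d)"
proof -
  have "openin (subtopology M (chart_dom c)) (chart_dom c \<inter> chart_dom d)"
    using assms by (auto simp: is_chart_def openin_subtopology)
  then have "openin (top_of_set (chart_target c)) (overlap c d)"
    using assms(1) unfolding is_chart_def overlap_def
    by (meson homeomorphic_imp_open_map open_map_def)
  then show ?thesis
    using assms(1) by (auto simp: is_chart_def openin_open_eq)
qed

lemma overlap_iff:
  assumes "is_chart M c"
  shows "x \<in> overlap c d \<longleftrightarrow> x \<in> chart_target c \<and> chart_inv c x \<in> chart_dom d"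
  unfolding overlap_def chart_target_def
  using chart_inv_coords[OF assms] by (auto simp: image_iff)

lemma transition_in_target:
  "is_chart M c \<Longrightarrow> x \<in> overlap c d \<Longrightarrow> transition c d x \<in> chart_target d"
  by (simp add: overlap_iff transition_def coords_in_target)

lemma pullback_wedge:
  assumes "\<And>v. \<omega> c x v = \<omega> d y (\<lambda>i. L (v i))" "\<And>v. \<theta> c x v = \<theta> d y (\<lambda>i. L (v i))"
  shows "wedge k l \<omega> \<theta> c x v = wedge k l \<omega> \<theta> d y (\<lambda>i. L (v i))"
  unfolding wedge_def assms ..

lemma pullback_wedge_power:
  assumes "\<And>v. \<omega> c x v = \<omega> d y (\<lambda>i. L (v i))"
  shows "wedge_power k \<omega> n c x v = wedge_power k \<omega> n d y (\<lambda>i. L (v i))"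
proof (induction n arbitrary: v)
  case 0
  then show ?case by (simp add: of_fun_def)
next
  case (Suc n)
  then show ?case using pullback_wedge[where \<omega>=\<omega> and c=c, OF assms] by simp
qed

lemma diff_form_smooth_form_on:
  "diff_form A k \<omega> \<Longrightarrow> c \<in> A \<Longrightarrow> smooth_form_on (chart_target c) k (\<omega> c)"
  by (simp add: diff_form_def smooth_form_on_def)

text \<open>Differentiating a pulled-back one-form also differentiates the Jacobian of the
  transition map. Those extra terms involve its second derivative, which is symmetric, so they
  cancel in the antisymmetrisation.\<close>

lemma pullback_ext_d:
  fixes \<omega> :: "('m, 'e::euclidean_space) form"
  assumes M: "smooth_manifold M A" and \<omega>: "diff_form A 1 \<omega>"
    and c: "c \<in> A" and d: "d \<in> A" and x: "x \<in> overlap c d"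
  shows "ext_d 1 \<omega> c x v = ext_d 1 \<omega> d (transition c d x) (\<lambda>i. frechet_derivative (transition c d) (at x) (v i))"
proof -
  let ?\<tau> = "transition c d"
  let ?S = "overlap c d"
  let ?L = "\<lambda>y. frechet_derivative ?\<tau> (at y)"
  have charts: "is_chart M c" "is_chart M d" and \<tau>: "smooth_on ?\<tau> ?S"
    using M c d by (auto simp: smooth_manifold_def)
  have S: "open ?S" by (rule open_overlap[OF charts])
  note T = is_chart_open_target[OF charts(1)] is_chart_open_target[OF charts(2)]
  note \<omega>c = diff_form_smooth_form_on[OF \<omega> c] and \<omega>d = diff_form_smooth_form_on[OF \<omega> d]
  have xc: "x \<in> chart_target c" and xd: "?\<tau> x \<in> chart_target d"
    using subsetD[OF overlap_subset_target x] transition_in_target[OF charts(1) x] by simp_all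
  have D: "frechet_derivative (\<lambda>y. \<omega> c y (\<lambda>_. u)) (at x) w =
      frechet_derivative (\<lambda>z. \<omega> d z (\<lambda>_. ?L x u)) (at (?\<tau> x)) (?L x w) +
      \<omega> d (?\<tau> x) (\<lambda>_. frechet_derivative (\<lambda>y. ?L y u) (at x) w)" for u w
  proof -
    have "frechet_derivative (\<lambda>y. \<omega> c y (\<lambda>_. u)) (at x) =
        frechet_derivative (\<lambda>y. \<omega> d (?\<tau> y) (\<lambda>_. ?L y u)) (at x)"
      using \<omega> c d by (intro frechet_derivative_cong_open[OF S x]) (simp add: diff_form_def)
    moreover have "((\<lambda>y. \<omega> d (?\<tau> y) (\<lambda>_. ?L y u)) has_derivative
        (\<lambda>w. frechet_derivative (\<lambda>z. \<omega> d z (\<lambda>_. ?L x u)) (at (?\<tau> x)) (?L x w) +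
          \<omega> d (?\<tau> x) (\<lambda>_. frechet_derivative (\<lambda>y. ?L y u) (at x) w))) (at x)"
    proof (rule has_derivative_pairing[where f="\<lambda>z u. \<omega> d z (\<lambda>_. u)", OF _ _ S x])
      show "(?\<tau> has_derivative ?L x) (at x)"
        by (rule smooth_on_imp_has_derivative[OF S \<tau> x])
      show "(\<lambda>z. \<omega> d z (\<lambda>_. u)) differentiable at (?\<tau> x)" for u
        using \<omega>d by (intro smooth_on_imp_differentiable[OF T(2) _ xd]) (simp add: smooth_form_on_def)
      show "linear (\<lambda>u. \<omega> d (?\<tau> y) (\<lambda>_. u))" if "y \<in> ?S" for y
        by (rule one_form_linear[OF \<omega>d transition_in_target[OF charts(1) that]])
      show "((\<lambda>y. ?L y u) has_derivative frechet_derivative (\<lambda>y. ?L y u) (at x)) (at x)"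
        by (rule smooth_on_imp_has_derivative[OF S smooth_on_frechet_derivative[OF \<tau>] x])
    qed
    ultimately show ?thesis by (simp add: frechet_derivative_at[symmetric])
  qed
  show ?thesis
    unfolding ext_d_one_form[where \<omega>=\<omega> and c=c, OF T(1) \<omega>c xc] ext_d_one_form[where \<omega>=\<omega> and c=d, OF T(2) \<omega>d xd] D
    using symmetric_second_derivative[OF S x \<tau>, of "v 1" "v 0"] by simp
qed

section \<open>The pencil of one-forms\<close>

lemma wedge_cong_at:
  "\<omega> c x = \<omega>' c x \<Longrightarrow> \<theta> c x = \<theta>' c x \<Longrightarrow> wedge k l \<omega> \<theta> c x = wedge k l \<omega>' \<theta>' c x"
  by (simp add: wedge_def fun_eq_iff)

lemma wedge_power_cong_at:
  "\<omega> c x = \<omega>' c x \<Longrightarrow> wedge_power k \<omega> n c x = wedge_power k \<omega>' n c x"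
  by (induction n) (auto intro: wedge_cong_at)

lemma sum_atMost_head:
  fixes K :: "nat \<Rightarrow> real"
  shows "(\<Sum>j\<le>n + 1. K j * t ^ j) = K 0 + (\<Sum>j = 1..n + 1. K j * t ^ j)"
  by (simp add: atMost_atLeast0 sum.atLeast_Suc_atMost)

definition pencil :: "('m, 'e) form \<Rightarrow> ('m, 'e) form \<Rightarrow> real \<Rightarrow> ('m, 'e) form" where
  "pencil \<eta> \<beta> t = \<eta> +\<^sub>F (\<lambda>_. t) *\<^sub>F \<beta>"

lemma pencil_apply: "pencil \<eta> \<beta> t c x v = \<eta> c x v + t * \<beta> c x v"
  by (simp add: pencil_def form_add_def form_scale_def)

lemma pencil_0: "pencil \<eta> \<beta> 0 = \<eta>"
  by (simp add: fun_eq_iff pencil_apply)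

text \<open>Existence and uniqueness of the expansion depend only on \<open>\<eta>\<close> and
  \<open>\<beta>\<close>; the Hamiltonian data are added later.\<close>

locale contact_pencil =
  fixes M :: "'m topology" and A :: "('m, 'e::euclidean_space) chart set" and n :: nat
    and \<eta> \<beta> :: "('m, 'e) form"
  assumes manifold: "smooth_manifold M A" and dim: "DIM('e) = 2 * n + 1"
    and contact: "contact_form A n \<eta>" and \<beta>: "diff_form A 1 \<beta>"
begin

text \<open>Built from the pencil of exterior derivatives, so that it is literally the left-hand
  side of \<open>expansion_coefficients\<close>. On chart targets, where the components are
  differentiable, it is the contact volume of the pencil.\<close>

definition pencil_volume :: "real \<Rightarrow> ('m, 'e) form" where
  "pencil_volume t = wedge 1 (n * 2) (pencil \<eta> \<beta> t) (wedge_power 2 (pencil (ext_d 1 \<eta>) (ext_d 1 \<beta>) t) n)"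

abbreviation \<mu> where "\<mu> \<equiv> contact_volume n \<eta>"

lemma chart: "c \<in> A \<Longrightarrow> is_chart M c"
  using manifold by (simp add: smooth_manifold_def)

lemma open_target: "c \<in> A \<Longrightarrow> open (chart_target c)"
  using chart is_chart_open_target by blast

lemma \<eta>: "diff_form A 1 \<eta>"
  using contact by (simp add: contact_form_def)

lemma smooth_form_on_\<eta>: "c \<in> A \<Longrightarrow> smooth_form_on (chart_target c) 1 (\<eta> c)"
  and smooth_form_on_\<beta>: "c \<in> A \<Longrightarrow> smooth_form_on (chart_target c) 1 (\<beta> c)"
  using \<eta> \<beta> diff_form_smooth_form_on by blast+

lemma smooth_form_on_pencil:
  assumes "c \<in> A"
  shows "smooth_form_on (chart_target c) 1 (pencil \<eta> \<beta> t c)"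
  using smooth_form_on_\<eta>[OF assms] smooth_form_on_\<beta>[OF assms] open_target[OF assms]
  unfolding smooth_form_on_def
  by (auto simp: pencil_apply[abs_def] intro!: smooth_on_add smooth_on_mult alternating_form_add alternating_form_cmult)

lemma ext_d_pencil:
  assumes c: "c \<in> A" and x: "x \<in> chart_target c"
  shows "ext_d 1 (pencil \<eta> \<beta> t) c x = pencil (ext_d 1 \<eta>) (ext_d 1 \<beta>) t c x"
proof
  fix v
  note S = open_target[OF c]
  have d: "(\<lambda>y. \<eta> c y w) differentiable at x" "(\<lambda>y. \<beta> c y w) differentiable at x" for w
    using smooth_form_on_\<eta>[OF c] smooth_form_on_\<beta>[OF c]
    by (auto simp: smooth_form_on_def intro!: smooth_on_imp_differentiable[OF S _ x])
  have "frechet_derivative (\<lambda>y. pencil \<eta> \<beta> t c y w) (at x) u =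
      frechet_derivative (\<lambda>y. \<eta> c y w) (at x) u + t * frechet_derivative (\<lambda>y. \<beta> c y w) (at x) u" for w u
    using d by (simp add: pencil_apply frechet_derivative_add frechet_derivative_mult differentiable_mult)
  then show "ext_d 1 (pencil \<eta> \<beta> t) c x v = pencil (ext_d 1 \<eta>) (ext_d 1 \<beta>) t c x v"
    unfolding pencil_apply ext_d_def by (simp add: algebra_simps)
qed

lemma pencil_volume_eq:
  assumes "c \<in> A" "x \<in> chart_target c"
  shows "pencil_volume t c x = contact_volume n (pencil \<eta> \<beta> t) c x"
  unfolding pencil_volume_def contact_volume_def
  by (intro wedge_cong_at wedge_power_cong_at refl ext_d_pencil[OF assms, symmetric])

lemma pencil_volume_0: "pencil_volume 0 = \<mu>"
  by (simp add: pencil_volume_def pencil_0 contact_volume_def)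

lemma alternating_pencil_volume:
  assumes "c \<in> A" "x \<in> chart_target c"
  shows "alternating_form DIM('e) (pencil_volume t c x)"
  using smooth_form_on_contact_volume[where c=c and \<omega>="pencil \<eta> \<beta> t", OF open_target smooth_form_on_pencil, of n] assms dim
  by (simp add: pencil_volume_eq smooth_form_on_def mult.commute)

lemma pullback_pencil_volume:
  assumes c: "c \<in> A" and d: "d \<in> A" and x: "x \<in> overlap c d"
  shows "pencil_volume t c x v =
    pencil_volume t d (transition c d x) (\<lambda>i. frechet_derivative (transition c d) (at x) (v i))"
  unfolding pencil_volume_def
  by (intro pullback_wedge pullback_wedge_power)
    (use \<eta> \<beta> assms pullback_ext_d[OF manifold \<eta> assms] pullback_ext_d[OF manifold \<beta> assms]
     in \<open>auto simp: pencil_apply diff_form_def\<close>)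

text \<open>The expansion in one chart, with the leading 1 kept as coefficient of index 0 so that
  whole polynomials in \<open>t\<close> can be compared.\<close>

definition coefficients_on :: "('m, 'e) chart \<Rightarrow> (nat \<Rightarrow> 'e \<Rightarrow> real) \<Rightarrow> bool" where
  "coefficients_on c K \<longleftrightarrow> (\<forall>j. smooth_on (K j) (chart_target c)) \<and> (\<forall>x\<in>chart_target c. K 0 x = 1) \<and>
     (\<forall>t. \<forall>x\<in>chart_target c. \<forall>v. pencil_volume t c x v = (\<Sum>j\<le>n + 1. K j x * t ^ j) * \<mu> c x v)"

text \<open>Both volumes have top degree, so their ratio can be read off on one fixed basis
  \<open>e\<close>. There the pencil volume is a polynomial in \<open>t\<close> of degree at most
  \<open>1 + n\<close>, and \<open>\<mu>\<close> is nonzero by contactness; dividing keeps the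
  coefficients smooth.\<close>

lemma coefficients_exist:
  assumes c: "c \<in> A"
  shows "\<exists>K. coefficients_on c K"
proof -
  note S = open_target[OF c]
  obtain e :: "nat \<Rightarrow> 'e" where e: "bij_betw e {..<DIM('e)} Basis"
    using ex_bij_betw_nat_finite[OF finite_Basis] by (auto simp: atLeast0LessThan)
  have alt\<mu>: "alternating_form DIM('e) (\<mu> c x)" if "x \<in> chart_target c" for x
    using alternating_pencil_volume[OF c that, of 0] by (simp add: pencil_volume_0)
  have \<mu>e: "\<mu> c x e \<noteq> 0" if "x \<in> chart_target c" for x
    using alternating_form_top_eq_0[OF alt\<mu>[OF that] e] contact c that by (auto simp: contact_form_def)
  have \<mu>sm: "smooth_on (\<lambda>x. \<mu> c x e) (chart_target c)"
    using smooth_form_on_contact_volume[where c=c and \<omega>=\<eta>, OF S smooth_form_on_\<eta>[OF c]]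
    by (simp add: smooth_form_on_def)
  have "poly_family_on (chart_target c) (1 + n) (\<lambda>t x. pencil_volume t c x e)"
    unfolding pencil_volume_def
  proof (rule poly_family_on_wedge[OF S])
    show "poly_family_on (chart_target c) 1 (\<lambda>t x. pencil \<eta> \<beta> t c x v)" for v
      using smooth_form_on_\<eta>[OF c] smooth_form_on_\<beta>[OF c] unfolding pencil_apply
      by (intro poly_family_on_affine) (auto simp: smooth_form_on_def)
    have "poly_family_on (chart_target c) 1 (\<lambda>t x. pencil (ext_d 1 \<eta>) (ext_d 1 \<beta>) t c x v)" for v
      using smooth_form_on_ext_d[where c=c and \<omega>=\<eta>, OF S smooth_form_on_\<eta>[OF c]]
        smooth_form_on_ext_d[where c=c and \<omega>=\<beta>, OF S smooth_form_on_\<beta>[OF c]] unfolding pencil_apply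
      by (intro poly_family_on_affine) (auto simp: smooth_form_on_def)
    then show "poly_family_on (chart_target c) n
        (\<lambda>t x. wedge_power 2 (pencil (ext_d 1 \<eta>) (ext_d 1 \<beta>) t) n c x v)" for v
      by (rule poly_family_on_wedge_power[OF S])
  qed
  then obtain K where K: "\<And>j. smooth_on (K j) (chart_target c)"
      "\<And>t x. x \<in> chart_target c \<Longrightarrow> pencil_volume t c x e = (\<Sum>j\<le>1 + n. K j x * t ^ j)"
    unfolding poly_family_on_def by blast
  define K' where "K' j x = K j x / \<mu> c x e" for j x
  have "smooth_on (K' j) (chart_target c)" for j
    unfolding K'_def using smooth_on_divide[OF S K(1) \<mu>sm \<mu>e] by simp
  moreover have "K' 0 x = 1" if x: "x \<in> chart_target c" for x
  proof -
    \<comment> \<open>At \<open>t = 0\<close> the pencil volume is \<open>\<mu>\<close>, and because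
      \<open>0 ^ 0 = 1\<close> only the coefficient of index 0 is left.\<close>
    have "\<mu> c x e = (\<Sum>j\<le>1 + n. K j x * 0 ^ j)"
      using K(2)[OF x, of 0] by (simp only: pencil_volume_0)
    also have "\<dots> = K 0 x"
      by (simp add: power_0_left if_distrib[of "\<lambda>r. _ * r"] sum.delta cong: if_cong)
    finally show ?thesis using \<mu>e[OF x] by (simp add: K'_def)
  qed
  moreover have "pencil_volume t c x v = (\<Sum>j\<le>n + 1. K' j x * t ^ j) * \<mu> c x v"
    if x: "x \<in> chart_target c" for t x v
  proof -
    have *: "(\<Sum>j\<le>n + 1. K' j x * t ^ j) = pencil_volume t c x e / \<mu> c x e"
      by (simp add: K(2)[OF x] K'_def sum_divide_distrib add_divide_distrib)
    show ?thesis
      unfolding *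
      using alternating_form_top_proportional[OF alternating_pencil_volume[OF c x, of t] alt\<mu>[OF x] e, of v] \<mu>e[OF x]
      by (simp add: field_simps)
  qed
  ultimately show ?thesis unfolding coefficients_on_def by blast
qed

lemma \<mu>_nonzero: "c \<in> A \<Longrightarrow> x \<in> chart_target c \<Longrightarrow> \<exists>v. \<mu> c x v \<noteq> 0"
  using contact by (auto simp: contact_form_def)

text \<open>The pencil volume transforms by pullback for every \<open>t\<close>, and
  \<open>\<mu>\<close> is its value at \<open>t = 0\<close>; both acquire the same factor, so the
  two polynomials in \<open>t\<close> agree.\<close>

lemma coefficients_transition:
  assumes c: "c \<in> A" "coefficients_on c K" and d: "d \<in> A" "coefficients_on d L"
    and x: "x \<in> overlap c d" and j: "j \<le> n + 1"
  shows "K j x = L j (transition c d x)"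
proof -
  have xc: "x \<in> chart_target c" and xd: "transition c d x \<in> chart_target d"
    using subsetD[OF overlap_subset_target x] transition_in_target[OF chart[OF c(1)] x] by simp_all
  obtain v where v: "\<mu> c x v \<noteq> 0" using \<mu>_nonzero[OF c(1) xc] by blast
  have "(\<Sum>j\<le>n + 1. K j x * t ^ j) * \<mu> c x v = (\<Sum>j\<le>n + 1. L j (transition c d x) * t ^ j) * \<mu> c x v" for t
    using pullback_pencil_volume[OF c(1) d(1) x, of t v] pullback_pencil_volume[OF c(1) d(1) x, of 0 v]
      c(2) d(2) xc xd unfolding coefficients_on_def pencil_volume_0 by metis
  then have "\<forall>t. (\<Sum>j\<le>n + 1. K j x * t ^ j) = (\<Sum>j\<le>n + 1. L j (transition c d x) * t ^ j)"
    using v by simp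
  then show ?thesis using j unfolding polyfun_eq_coeffs by blast
qed

lemma expansion_coefficients_exist: "\<exists>C. expansion_coefficients A n \<eta> \<beta> C"
proof -
  obtain K where K: "\<And>c. c \<in> A \<Longrightarrow> coefficients_on c (K c)"
    using bchoice[of A coefficients_on] coefficients_exist by blast
  \<comment> \<open>Some chart around each point; by the transition lemma the resulting value does
    not depend on the choice.\<close>
  define sel where "sel p = (SOME c. c \<in> A \<and> p \<in> chart_dom c)" for p
  define C where "C j p = K (sel p) j (coords (sel p) p)" for j p
  have C: "C j (chart_inv c x) = K c j x" if c: "c \<in> A" and x: "x \<in> chart_target c" and j: "j \<le> n + 1" for c x j
  proof -
    have sel: "sel (chart_inv c x) \<in> A \<and> chart_inv c x \<in> chart_dom (sel (chart_inv c x))"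
      unfolding sel_def by (rule someI[of _ c]) (simp add: c chart_inv_in_dom[OF x])
    then have "x \<in> overlap c (sel (chart_inv c x))"
      using x by (simp add: overlap_iff[OF chart[OF c]])
    from coefficients_transition[OF c K[OF c] _ K this j] sel show ?thesis
      by (simp add: C_def transition_def)
  qed
  have "pencil_volume t c x = ((\<lambda>p. 1 + (\<Sum>j = 1..n + 1. C j p * t ^ j)) *\<^sub>F \<mu>) c x"
    if c: "c \<in> A" and x: "x \<in> chart_target c" for t c x
  proof
    fix v
    have "pencil_volume t c x v = (\<Sum>j\<le>n + 1. K c j x * t ^ j) * \<mu> c x v" "K c 0 x = 1"
      using K[OF c] x by (auto simp: coefficients_on_def)
    then show "pencil_volume t c x v = ((\<lambda>p. 1 + (\<Sum>j = 1..n + 1. C j p * t ^ j)) *\<^sub>F \<mu>) c x v"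
      unfolding sum_atMost_head by (simp add: form_scale_def C[OF c x])
  qed
  then show ?thesis
    unfolding expansion_coefficients_def form_eq_def pencil_volume_def pencil_def by blast
qed

text \<open>Uniqueness: any \<open>C\<close> satisfying the expansion, not only the one glued above,
  is locally given by the smooth coefficients, since a polynomial in real \<open>t\<close>
  determines its coefficients.\<close>

lemma expansion_coefficients_eq:
  assumes C: "expansion_coefficients A n \<eta> \<beta> C" and c: "c \<in> A" and K: "coefficients_on c K"
    and x: "x \<in> chart_target c" and j: "j \<in> {1..n + 1}"
  shows "C j (chart_inv c x) = K j x"
proof -
  obtain v where v: "\<mu> c x v \<noteq> 0" using \<mu>_nonzero[OF c x] by blast
  let ?C = "\<lambda>j. if j = 0 then 1 else C j (chart_inv c x)"
  have "(\<Sum>j\<le>n + 1. ?C j * t ^ j) = (\<Sum>j\<le>n + 1. K j x * t ^ j)" for t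
  proof -
    have "pencil_volume t c x = ((\<lambda>p. 1 + (\<Sum>j = 1..n + 1. C j p * t ^ j)) *\<^sub>F \<mu>) c x"
      using C c x unfolding expansion_coefficients_def form_eq_def pencil_volume_def pencil_def by blast
    then have "pencil_volume t c x v = (\<Sum>j\<le>n + 1. ?C j * t ^ j) * \<mu> c x v"
      unfolding sum_atMost_head by (simp add: form_scale_def)
    then show ?thesis using K x v by (simp add: coefficients_on_def)
  qed
  then have "\<forall>j\<le>n + 1. ?C j = K j x" unfolding polyfun_eq_coeffs[symmetric] by blast
  then show ?thesis using j by auto
qed

text \<open>Writing the pencil volume as \<open>g t\<close> times \<open>\<mu>\<close>, the Leibniz
  rule leaves \<open>X(g t) * \<mu> = 0\<close>, as both volumes scale by the same factor. Then
  \<open>X(g t)\<close> is a polynomial in \<open>t\<close> with coefficients \<open>X(K j)\<close>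
  that vanishes for all real \<open>t\<close>.\<close>

lemma coefficients_conserved_on_chart:
  assumes c: "c \<in> A" and K: "coefficients_on c K" and x: "x \<in> chart_target c" and j: "j \<le> n + 1"
    and X: "smooth_on (X c) (chart_target c)" and f: "f differentiable at x"
    and L\<eta>: "\<And>y v. y \<in> chart_target c \<Longrightarrow> lie_deriv 1 X \<eta> c y v = - f y * \<eta> c y v"
    and L\<beta>: "\<And>y v. y \<in> chart_target c \<Longrightarrow> lie_deriv 1 X \<beta> c y v = - f y * \<beta> c y v"
  shows "frechet_derivative (K j) (at x) (X c x) = 0"
proof -
  note S = open_target[OF c]
  define g where "g t y = (\<Sum>j\<le>n + 1. K j y * t ^ j)" for t y
  obtain v where v: "\<mu> c x v \<noteq> 0" using \<mu>_nonzero[OF c x] by blast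
  have Ksm: "smooth_on (K j) (chart_target c)" for j
    using K by (simp add: coefficients_on_def)
  have gsm: "smooth_on (g t) (chart_target c)" for t
    unfolding g_def by (intro smooth_on_sum smooth_on_mult S Ksm smooth_on_const)
  have \<mu>sm: "smooth_on (\<lambda>y. \<mu> c y v) (chart_target c)"
    using smooth_form_on_contact_volume[where c=c and \<omega>=\<eta>, OF S smooth_form_on_\<eta>[OF c]]
    by (simp add: smooth_form_on_def)
  note d = smooth_on_imp_differentiable[OF S _ x]
  have E: "contact_volume n (pencil \<eta> \<beta> t) c y w = g t y * \<mu> c y w" if "y \<in> chart_target c" for t y w
    using K that by (simp add: coefficients_on_def pencil_volume_eq[OF c that, symmetric] g_def)
  have L: "lie_deriv 1 X (pencil \<eta> \<beta> t) c y w = - f y * pencil \<eta> \<beta> t c y w" if y: "y \<in> chart_target c" for t y w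
  proof -
    have "(\<lambda>y. \<eta> c y w) differentiable at y" "(\<lambda>y. \<beta> c y w) differentiable at y"
      using smooth_form_on_\<eta>[OF c] smooth_form_on_\<beta>[OF c]
      by (auto simp: smooth_form_on_def intro!: smooth_on_imp_differentiable[OF S _ y])
    then have "lie_deriv 1 X (pencil \<eta> \<beta> t) c y w = lie_deriv 1 X \<eta> c y w + t * lie_deriv 1 X \<beta> c y w"
      by (simp add: lie_deriv_def pencil_apply frechet_derivative_add frechet_derivative_mult
          differentiable_mult algebra_simps)
    then show ?thesis unfolding L\<eta>[OF y] L\<beta>[OF y] by (simp add: pencil_apply algebra_simps)
  qed
  have dg: "frechet_derivative (g t) (at x) (X c x) = 0" for t
  proof -
    let ?k = "1 + n * 2"
    have L1: "lie_deriv ?k X (contact_volume n (pencil \<eta> \<beta> t)) c x v =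
        - (of_nat (n + 1) * f x) * (g t x * \<mu> c x v)"
      using lie_deriv_contact_volume[where c=c and \<omega>="pencil \<eta> \<beta> t", OF S x smooth_form_on_pencil[OF c] X L f]
      by (simp only: E[OF x])
    have L0: "lie_deriv ?k X \<mu> c x v = - (of_nat (n + 1) * f x) * \<mu> c x v"
      by (rule lie_deriv_contact_volume[where c=c and \<omega>=\<eta>, OF S x smooth_form_on_\<eta>[OF c] X L\<eta> f])
    have "frechet_derivative (\<lambda>y. contact_volume n (pencil \<eta> \<beta> t) c y v) (at x) =
        frechet_derivative (\<lambda>y. g t y * \<mu> c y v) (at x)"
      by (rule frechet_derivative_cong_open[OF S x E])
    \<comment> \<open>The slot terms are evaluated at \<open>x\<close>, where \<open>g t x\<close>
      is a constant factor; only the directional derivative produces an extra term.\<close>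
    then have "lie_deriv ?k X (contact_volume n (pencil \<eta> \<beta> t)) c x v =
        frechet_derivative (g t) (at x) (X c x) * \<mu> c x v + g t x * lie_deriv ?k X \<mu> c x v"
      by (simp add: lie_deriv_def E[OF x] frechet_derivative_mult[OF d[OF gsm] d[OF \<mu>sm]]
          sum_distrib_left distrib_left)
    then have "frechet_derivative (g t) (at x) (X c x) * \<mu> c x v = 0"
      unfolding L1 L0 by (simp add: algebra_simps)
    then show ?thesis using v by simp
  qed
  have "(\<Sum>j\<le>n + 1. frechet_derivative (K j) (at x) (X c x) * t ^ j) = 0" for t
  proof -
    have "(g t has_derivative (\<lambda>w. \<Sum>j\<le>n + 1. frechet_derivative (K j) (at x) w * t ^ j)) (at x)"
      unfolding g_def
      by (intro has_derivative_sum has_derivative_mult_left smooth_on_imp_has_derivative[OF S Ksm x])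
    from trans[OF fun_cong[OF frechet_derivative_at[OF this]] dg] show ?thesis .
  qed
  then have "\<forall>j\<le>n + 1. frechet_derivative (K j) (at x) (X c x) = 0"
    unfolding polyfun_eq_0[symmetric] by blast
  then show ?thesis using j by blast
qed

end

section \<open>Contact Hamiltonian systems\<close>

text \<open>\<open>vf_apply\<close> evaluates in an arbitrarily chosen chart around the point, so
  the equation is demanded in all charts.\<close>

lemma dissipatedI:
  assumes M: "smooth_manifold M A" and f: "smooth_fun A f"
    and D: "\<And>c x. c \<in> A \<Longrightarrow> x \<in> chart_target c \<Longrightarrow>
      frechet_derivative (\<lambda>y. f (chart_inv c y)) (at x) (X c x) = - a (chart_inv c x) * f (chart_inv c x)"
  shows "dissipated M A X a f"
  unfolding dissipated_def
proof (intro conjI ballI f)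
  fix p assume "p \<in> topspace M"
  define c where "c = (SOME c. c \<in> A \<and> p \<in> chart_dom c)"
  have "\<exists>c. c \<in> A \<and> p \<in> chart_dom c"
    using M \<open>p \<in> topspace M\<close> unfolding smooth_manifold_def by blast
  from someI_ex[OF this] have c: "c \<in> A" "p \<in> chart_dom c"
    unfolding c_def by simp_all
  have "chart_inv c (coords c p) = p"
    using M c by (intro chart_inv_coords) (auto simp: smooth_manifold_def)
  then show "vf_apply A X f p = - a p * f p"
    using D[OF c(1) coords_in_target[OF c(2)]]
    by (simp add: vf_apply_def fun_of_def c_def[symmetric] lie_deriv_def of_fun_def Let_def)
qed

lemma conserved_iff_dissipated: "conserved M A X f \<longleftrightarrow> dissipated M A X (\<lambda>_. 0) f"
  by (simp add: conserved_def dissipated_def)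

lemma ext_d_0_of_fun:
  "ext_d 0 (of_fun f) c x v = frechet_derivative (\<lambda>y. f (chart_inv c y)) (at x) (v 0)"
  by (simp add: ext_d_def of_fun_def)

text \<open>\<open>fun_of\<close> uses a chosen chart; the pushforward law of \<open>X\<close> and
  the pullback law of \<open>\<omega>\<close> compensate each other, so any chart gives the same
  value.\<close>

lemma fun_of_pairing:
  fixes \<omega> :: "('m, 'e::euclidean_space) form"
  assumes M: "smooth_manifold M A" and \<omega>: "diff_form A 1 \<omega>" and X: "vector_field A X"
    and c: "c \<in> A" and x: "x \<in> chart_target c"
  shows "fun_of A (interior_prod X \<omega>) (chart_inv c x) = \<omega> c x (\<lambda>_. X c x)"
proof -
  define p where "p = chart_inv c x"
  define d where "d = (SOME c. c \<in> A \<and> p \<in> chart_dom c)"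
  have d: "d \<in> A" "p \<in> chart_dom d"
    using someI[of "\<lambda>c. c \<in> A \<and> p \<in> chart_dom c" c] c chart_inv_in_dom[OF x]
    unfolding d_def p_def by auto
  have xo: "x \<in> overlap c d"
    using M c x d(2) by (subst overlap_iff) (auto simp: smooth_manifold_def p_def)
  have \<tau>: "transition c d x = coords d p"
    by (simp add: transition_def p_def)
  have "fun_of A (interior_prod X \<omega>) p = \<omega> d (coords d p) (case_nat (X d (coords d p)) (\<lambda>_. 0))"
    by (simp add: fun_of_def d_def[symmetric] interior_prod_def Let_def)
  also have "\<dots> = \<omega> d (coords d p) (\<lambda>_. X d (coords d p))"
    using one_form_first[OF diff_form_smooth_form_on[OF \<omega> d(1)] coords_in_target[OF d(2)],
        of "case_nat _ _"] by simp
  also have "\<dots> = \<omega> c x (\<lambda>_. X c x)"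
    using \<omega> X c d(1) xo by (simp add: diff_form_def vector_field_def flip: \<tau>)
  finally show ?thesis by (simp add: p_def)
qed

locale contact_hamiltonian = contact_pencil M A n \<eta> \<beta>
  for M :: "'m topology" and A :: "('m, 'e::euclidean_space) chart set" and n \<eta> \<beta> +
  fixes H a :: "'m \<Rightarrow> real" and R X :: "('m, 'e) vfield"
  assumes H: "smooth_fun A H" and R: "reeb_field A \<eta> R"
    and X: "contact_hamiltonian_field A \<eta> H R X" and a: "a = vf_apply A R H"
    and lie_\<beta>: "form_eq A (lie_deriv 1 X \<beta>) ((\<lambda>p. - a p) *\<^sub>F \<beta>)"
begin

context
  fixes c assumes c: "c \<in> A"
begin

abbreviation h where "h \<equiv> \<lambda>y. H (chart_inv c y)"

lemma smooth_h: "smooth_on h (chart_target c)"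
  using H c by (simp add: smooth_fun_def comp_def)

lemma smooth_X: "smooth_on (X c) (chart_target c)" and smooth_R: "smooth_on (R c) (chart_target c)"
  using X R c by (auto simp: contact_hamiltonian_field_def reeb_field_def vector_field_def)

lemma one_form_case_nat:
  assumes "smooth_form_on (chart_target c) 1 (\<omega> c)" "x \<in> chart_target c"
  shows "\<omega> c x (case_nat u v) = \<omega> c x (\<lambda>_. u)"
  using one_form_first[OF assms, of "case_nat u v"] by simp

lemma \<eta>_X: "x \<in> chart_target c \<Longrightarrow> \<eta> c x (\<lambda>_. X c x) = - h x"
  and \<eta>_R: "x \<in> chart_target c \<Longrightarrow> \<eta> c x (\<lambda>_. R c x) = 1"
  using X R c one_form_case_nat[where \<omega>=\<eta>, OF smooth_form_on_\<eta>[OF c]]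
  by (auto simp: contact_hamiltonian_field_def reeb_field_def form_eq_def interior_prod_def of_fun_def fun_eq_iff)

text \<open>The exterior derivative of \<open>\<eta>\<close> in the chart as a bilinear expression,
  whose antisymmetry is visible from its shape.\<close>

definition d\<eta> where
  "d\<eta> x u w = frechet_derivative (\<lambda>y. \<eta> c y (\<lambda>_. w)) (at x) u - frechet_derivative (\<lambda>y. \<eta> c y (\<lambda>_. u)) (at x) w"

lemma d\<eta>: "x \<in> chart_target c \<Longrightarrow> ext_d 1 \<eta> c x (case_nat u (\<lambda>_. w)) = d\<eta> x u w"
  unfolding d\<eta>_def
  by (subst ext_d_one_form[where \<omega>=\<eta> and c=c, OF open_target[OF c] smooth_form_on_\<eta>[OF c]]) simp_all

lemma d\<eta>_R: "x \<in> chart_target c \<Longrightarrow> d\<eta> x (R c x) w = 0"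
  using R c d\<eta>[of x "R c x" w]
  by (simp add: reeb_field_def form_eq_def interior_prod_def fun_eq_iff)

lemma d\<eta>_X:
  assumes x: "x \<in> chart_target c"
  shows "d\<eta> x (X c x) w = frechet_derivative h (at x) w - a (chart_inv c x) * \<eta> c x (\<lambda>_. w)"
proof -
  have "interior_prod X (ext_d 1 \<eta>) c x (\<lambda>_. w) =
      (ext_d 0 (of_fun H) +\<^sub>F (\<lambda>p. - vf_apply A R H p) *\<^sub>F \<eta>) c x (\<lambda>_. w)"
    using X c x by (simp add: contact_hamiltonian_field_def form_eq_def)
  then show ?thesis
    using d\<eta>[OF x, of "X c x" w]
    by (simp add: interior_prod_def form_add_def form_scale_def ext_d_0_of_fun a)
qed

text \<open>Evaluate the equation for \<open>d\<eta>(X, -)\<close> on \<open>R\<close>: the left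
  side is zero and \<open>\<eta>(R) = 1\<close>. This gives a formula for \<open>a\<close> in every
  chart without comparing it with the chart chosen by \<open>vf_apply\<close>.\<close>

lemma a_chart:
  assumes x: "x \<in> chart_target c"
  shows "a (chart_inv c x) = frechet_derivative h (at x) (R c x)"
proof -
  have "d\<eta> x (X c x) (R c x) = - d\<eta> x (R c x) (X c x)" by (simp add: d\<eta>_def)
  then show ?thesis using d\<eta>_X[OF x, of "R c x"] d\<eta>_R[OF x] \<eta>_R[OF x] by simp
qed

text \<open>Evaluate the equation for \<open>d\<eta>(X, -)\<close> on \<open>X\<close> itself and
  use \<open>\<eta>(X) = -H\<close>.\<close>

lemma X_H:
  assumes x: "x \<in> chart_target c"
  shows "frechet_derivative h (at x) (X c x) = - a (chart_inv c x) * h x"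
proof -
  have "d\<eta> x (X c x) (X c x) = 0" by (simp add: d\<eta>_def)
  then show ?thesis using d\<eta>_X[OF x, of "X c x"] \<eta>_X[OF x] by simp
qed

text \<open>In the chart \<open>a\<close> is \<open>dH\<close> paired with the smooth field
  \<open>R\<close>. Differentiability of \<open>a\<close> is required because the argument on
  \<open>d\<omega>\<close> differentiates the scaling factor.\<close>

lemma differentiable_a:
  assumes x: "x \<in> chart_target c"
  shows "(\<lambda>y. a (chart_inv c y)) differentiable at x"
proof -
  note S = open_target[OF c]
  have "linear (frechet_derivative h (at y))" if "y \<in> chart_target c" for y
    using smooth_on_imp_differentiable[OF S smooth_h that] by (rule linear_frechet_derivative)
  then have "smooth_on (\<lambda>y. frechet_derivative h (at y) (R c y)) (chart_target c)"
    by (rule smooth_on_pairing[OF S _ smooth_on_frechet_derivative[OF smooth_h] smooth_R])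
  then have "smooth_on (\<lambda>y. a (chart_inv c y)) (chart_target c)"
    by (subst smooth_on_cong[OF S a_chart])
  then show ?thesis by (rule smooth_on_imp_differentiable[OF S _ x])
qed

lemma lie_deriv_one_form:
  assumes "smooth_form_on (chart_target c) 1 (\<omega> c)" "x \<in> chart_target c"
  shows "lie_deriv 1 X \<omega> c x v = frechet_derivative (\<lambda>y. \<omega> c y (\<lambda>_. v 0)) (at x) (X c x) +
    \<omega> c x (\<lambda>_. frechet_derivative (X c) (at x) (v 0))"
proof -
  have "frechet_derivative (\<lambda>y. \<omega> c y v) (at x) = frechet_derivative (\<lambda>y. \<omega> c y (\<lambda>_. v 0)) (at x)"
    by (rule frechet_derivative_cong_open[OF open_target[OF c] assms(2) one_form_first[OF assms(1)]])
  then show ?thesis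
    using one_form_first[OF assms, of "v(0 := _)"] by (simp add: lie_deriv_def)
qed

lemma frechet_derivative_contraction:
  assumes \<omega>: "smooth_form_on (chart_target c) 1 (\<omega> c)" and x: "x \<in> chart_target c"
  shows "frechet_derivative (\<lambda>y. \<omega> c y (\<lambda>_. X c y)) (at x) w =
    frechet_derivative (\<lambda>y. \<omega> c y (\<lambda>_. X c x)) (at x) w + \<omega> c x (\<lambda>_. frechet_derivative (X c) (at x) w)"
  by (rule frechet_derivative_pairing[where f="\<lambda>y u. \<omega> c y (\<lambda>_. u)", OF open_target[OF c] x one_form_linear[OF \<omega>] _ smooth_X])
    (use \<omega> in \<open>simp_all add: smooth_form_on_def\<close>)

text \<open>Cartan's formula in coordinates: the Lie derivative is
  \<open>d\<eta>(X, -) + d(\<eta>(X))\<close>, and the two occurrences of \<open>dH\<close>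
  cancel.\<close>

lemma lie_deriv_\<eta>:
  assumes x: "x \<in> chart_target c"
  shows "lie_deriv 1 X \<eta> c x v = - a (chart_inv c x) * \<eta> c x v"
proof -
  have "frechet_derivative (\<lambda>y. \<eta> c y (\<lambda>_. X c y)) (at x) = frechet_derivative (\<lambda>y. - 1 * h y) (at x)"
    using \<eta>_X by (intro frechet_derivative_cong_open[OF open_target[OF c] x]) simp
  then have "frechet_derivative (\<lambda>y. \<eta> c y (\<lambda>_. X c y)) (at x) w = - frechet_derivative h (at x) w" for w
    using frechet_derivative_mult[of "\<lambda>_. -1" x h w] smooth_on_imp_differentiable[OF open_target[OF c] smooth_h x]
    by simp
  then show ?thesis
    using d\<eta>_X[OF x, of "v 0"] frechet_derivative_contraction[where \<omega>=\<eta>, OF smooth_form_on_\<eta>[OF c] x, of "v 0"]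
      one_form_first[OF smooth_form_on_\<eta>[OF c] x, of v]
    unfolding lie_deriv_one_form[where \<omega>=\<eta>, OF smooth_form_on_\<eta>[OF c] x] d\<eta>_def by simp
qed

lemma lie_deriv_\<beta>:
  assumes "x \<in> chart_target c"
  shows "lie_deriv 1 X \<beta> c x v = - a (chart_inv c x) * \<beta> c x v"
  using lie_\<beta> c assms by (simp add: form_eq_def form_scale_def)

text \<open>On the argument \<open>X c x\<close> the Lie derivative of \<open>\<beta>\<close> is, by
  the product rule, the derivative of \<open>\<beta>(X)\<close> along \<open>X\<close>; this is
  \<open>[X, X] = 0\<close> in coordinates.\<close>

lemma X_J:
  assumes x: "x \<in> chart_target c"
  shows "frechet_derivative (\<lambda>y. \<beta> c y (\<lambda>_. X c y)) (at x) (X c x) =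
    - a (chart_inv c x) * \<beta> c x (\<lambda>_. X c x)"
  using lie_deriv_\<beta>[OF x, of "\<lambda>_. X c x"]
    frechet_derivative_contraction[where \<omega>=\<beta>, OF smooth_form_on_\<beta>[OF c] x]
  unfolding lie_deriv_one_form[where \<omega>=\<beta>, OF smooth_form_on_\<beta>[OF c] x] by simp

lemma X_coefficient:
  "coefficients_on c K \<Longrightarrow> x \<in> chart_target c \<Longrightarrow> j \<le> n + 1 \<Longrightarrow>
    frechet_derivative (K j) (at x) (X c x) = 0"
  by (rule coefficients_conserved_on_chart[OF c _ _ _ smooth_X differentiable_a lie_deriv_\<eta> lie_deriv_\<beta>])

end

lemma dissipated_J: "dissipated M A X a (\<lambda>p. - fun_of A (interior_prod X \<beta>) p)" (is "dissipated M A X a ?J")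
proof (rule dissipatedI[OF manifold])
  have vX: "vector_field A X" using X by (simp add: contact_hamiltonian_field_def)
  have J: "?J (chart_inv c x) = - 1 * \<beta> c x (\<lambda>_. X c x)" if "c \<in> A" "x \<in> chart_target c" for c x
    by (simp add: fun_of_pairing[OF manifold \<beta> vX that])
  have sm: "smooth_on (\<lambda>x. \<beta> c x (\<lambda>_. X c x)) (chart_target c)" if c: "c \<in> A" for c
    using smooth_form_on_\<beta>[OF c]
    by (intro smooth_on_pairing[where f="\<lambda>y u. \<beta> c y (\<lambda>_. u)", OF open_target[OF c]
          one_form_linear[OF smooth_form_on_\<beta>[OF c]] _ smooth_X[OF c]])
      (simp_all add: smooth_form_on_def)
  show "smooth_fun A ?J"
    unfolding smooth_fun_def comp_def
  proof
    fix c assume c: "c \<in> A"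
    have "smooth_on (\<lambda>x. - 1 * \<beta> c x (\<lambda>_. X c x)) (chart_target c)"
      by (intro smooth_on_mult open_target[OF c] smooth_on_const sm[OF c])
    then show "smooth_on (\<lambda>x. ?J (chart_inv c x)) (chart_target c)"
      by (subst smooth_on_cong[OF open_target[OF c] J[OF c]])
  qed
  fix c x assume c: "c \<in> A" and x: "x \<in> chart_target c"
  have "frechet_derivative (\<lambda>y. ?J (chart_inv c y)) (at x) =
      frechet_derivative (\<lambda>y. - 1 * \<beta> c y (\<lambda>_. X c y)) (at x)"
    by (rule frechet_derivative_cong_open[OF open_target[OF c] x J[OF c]])
  then show "frechet_derivative (\<lambda>y. ?J (chart_inv c y)) (at x) (X c x) =
      - a (chart_inv c x) * ?J (chart_inv c x)"
    using frechet_derivative_mult[of "\<lambda>_. -1" x "\<lambda>y. \<beta> c y (\<lambda>_. X c y)" "X c x"]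
      smooth_on_imp_differentiable[OF open_target[OF c] sm[OF c] x] X_J[OF c x] J[OF c x]
    by simp
qed

text \<open>The expansion says nothing directly about smoothness of \<open>C\<close>; on each chart
  \<open>C j\<close> agrees with a smooth local coefficient, which supplies both smoothness and the
  vanishing of \<open>X(C j)\<close>.\<close>

lemma coefficient_conserved_dissipated:
  assumes C: "expansion_coefficients A n \<eta> \<beta> C" and j: "j \<in> {1..n + 1}"
  shows "conserved M A X (C j)" "dissipated M A X a (\<lambda>p. H p * C j p)"
proof -
  have chart: "smooth_on (\<lambda>y. C j (chart_inv c y)) (chart_target c) \<and>
      (\<forall>x\<in>chart_target c. frechet_derivative (\<lambda>y. C j (chart_inv c y)) (at x) (X c x) = 0)"
    if c: "c \<in> A" for c
  proof -
    note S = open_target[OF c]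
    obtain K where K: "coefficients_on c K" using coefficients_exist[OF c] by blast
    note eq = expansion_coefficients_eq[OF C c K _ j]
    have "smooth_on (\<lambda>y. C j (chart_inv c y)) (chart_target c)"
      using K by (subst smooth_on_cong[OF S eq]) (simp_all add: coefficients_on_def)
    moreover have "frechet_derivative (\<lambda>y. C j (chart_inv c y)) (at x) (X c x) = 0"
      if x: "x \<in> chart_target c" for x
    proof -
      have "frechet_derivative (\<lambda>y. C j (chart_inv c y)) (at x) = frechet_derivative (K j) (at x)"
        by (rule frechet_derivative_cong_open[OF S x eq])
      then show ?thesis using X_coefficient[OF c K x] j by simp
    qed
    ultimately show ?thesis by blast
  qed
  show "conserved M A X (C j)"
    unfolding conserved_iff_dissipated
    by (rule dissipatedI[OF manifold]) (use chart in \<open>auto simp: smooth_fun_def comp_def\<close>)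
  show "dissipated M A X a (\<lambda>p. H p * C j p)"
  proof (rule dissipatedI[OF manifold])
    show "smooth_fun A (\<lambda>p. H p * C j p)"
      using chart by (auto simp: smooth_fun_def comp_def intro!: smooth_on_mult open_target smooth_h)
    fix c x assume c: "c \<in> A" and x: "x \<in> chart_target c"
    note d = smooth_on_imp_differentiable[OF open_target[OF c] _ x]
    show "frechet_derivative (\<lambda>y. H (chart_inv c y) * C j (chart_inv c y)) (at x) (X c x) =
        - a (chart_inv c x) * (H (chart_inv c x) * C j (chart_inv c x))"
      using frechet_derivative_mult[OF d[OF smooth_h[OF c]] d[OF conjunct1[OF chart[OF c]]], of "X c x"]
        chart[OF c] x X_H[OF c x] by simp
  qed
qed

end

theorem proposition2:
  fixes M :: "'m topology"
    and A :: "('m, 'e::euclidean_space) chart set"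
    and n :: nat
    and \<eta> \<beta> :: "('m, 'e) form"
    and R X :: "('m, 'e) vfield"
    and H a J :: "'m \<Rightarrow> real"
  assumes "n \<ge> 1"
    and "contact_hamiltonian_system M A n \<eta> H"
    and "reeb_field A \<eta> R"
    and "contact_hamiltonian_field A \<eta> H R X"
    and "a = vf_apply A R H"
    and "diff_form A 1 \<beta>"
    and "form_eq A (lie_deriv 1 X \<beta>) ((\<lambda>p. - a p) *\<^sub>F \<beta>)"
    and "J = (\<lambda>p. - fun_of A (interior_prod X \<beta>) p)"
  shows "dissipated M A X a J \<and>
    (\<exists>C. expansion_coefficients A n \<eta> \<beta> C) \<and>
    (\<forall>C. expansion_coefficients A n \<eta> \<beta> C \<longrightarrow>
       (\<forall>j\<in>{1..n + 1}. conserved M A X (C j) \<and> dissipated M A X a (\<lambda>p. H p * C j p)))"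
proof -
  interpret contact_hamiltonian M A n \<eta> \<beta> H a R X
    using assms by unfold_locales (auto simp: contact_hamiltonian_system_def)
  show ?thesis
    using dissipated_J expansion_coefficients_exist coefficient_conserved_dissipated assms(8) by blast
qed

end
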